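(* Let $M$ be a manifold. Then $(\mathrm{Ran}(M),\tau_{\mathrm{fin}})$ is naively conical. More explicitly, for any $X\in\mathrm{Ran}(M)$, with $\mathrm{card}(X)=n$, there exist a neighborhood $U\subset\mathrm{Ran}(M)$ of $X$ for $\tau_{\mathrm{fin}}$, a Euclidean space $E$, and a stratified space $L\to\{n+1,n+2,\dots\}$, together with a stratified homeomorphism $U\to E\times c_q(L)$.
   Context: $\mathrm{Ran}(M)$ is the set of non-empty finite subsets of $M$. For $n\ge1$ let $\pi_n\colon M^n\to\mathrm{Ran}(M)$ send a tuple to its set of coordinates. The final topology $\tau_{\mathrm{fin}}$ on $\mathrm{Ran}(M)$ is the finest topology making all $\pi_n$ continuous. $\mathrm{Ran}(M)$ is stratified by $\mathrm{card}\colon\mathrm{Ran}(M)\to\mathbb{N}_{\ge1}$. A poset $P$ carries the Alexandrov topology, whose open sets are the upward closed subsets; a space stratified over $P$ is a topological space $T$ with a continuous map $T\to P$. Subsets of $\mathbb{N}$ carry the usual order. For a space $L$ stratified by $\varphi_L\colon L\to\{n+1,n+2,\dots\}$, $c_q(L)$ denotes the cone $L\times[0,1)/(L\times\{0\})$ equipped with the quotient topology (the cone on the empty space being a point), stratified over $\{n,n+1,\dots\}$ by sending $[(x,t)]$ to $\varphi_L(x)$ if $t>0$ and to $n$ if $t=0$. The product $E\times c_q(L)$ is stratified through its second factor. A stratified homeomorphism $U\to E\times c_q(L)$ is a homeomorphism compatible with the stratifications, where $U$ is stratified by the restriction of $\mathrm{card}$. *)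

theory Defs
  imports "HOL-Analysis.Analysis"
begin

text \<open>The dimension of a manifold may vary from one connected component to another.\<close>

definition topological_manifold :: "'a topology \<Rightarrow> bool" where
  "topological_manifold M \<longleftrightarrow>
     Hausdorff_space M \<and> second_countable M \<and>
     (\<forall>x \<in> topspace M. \<exists>d U V. openin M U \<and> x \<in> U \<and> openin (Euclidean_space d) V \<and>
        subtopology M U homeomorphic_space subtopology (Euclidean_space d) V)"

definition neighbourhood_of :: "'a topology \<Rightarrow> 'a \<Rightarrow> 'a set \<Rightarrow> bool" where
  "neighbourhood_of T x U \<longleftrightarrow> U \<subseteq> topspace T \<and> (\<exists>V. openin T V \<and> x \<in> V \<and> V \<subseteq> U)"

definition final_topology ::
    "'b set \<Rightarrow> 'i set \<Rightarrow> ('i \<Rightarrow> 'a topology) \<Rightarrow> ('i \<Rightarrow> 'a \<Rightarrow> 'b) \<Rightarrow> 'b topology" where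
  "final_topology Y I X f =
     topology (\<lambda>U. U \<subseteq> Y \<and> (\<forall>i\<in>I. openin (X i) {x \<in> topspace (X i). f i x \<in> U}))"

lemma openin_final_topology:
  "openin (final_topology Y I X f) U \<longleftrightarrow>
     U \<subseteq> Y \<and> (\<forall>i\<in>I. openin (X i) {x \<in> topspace (X i). f i x \<in> U})"
proof -
  let ?P = "\<lambda>U. U \<subseteq> Y \<and> (\<forall>i\<in>I. openin (X i) {x \<in> topspace (X i). f i x \<in> U})"
  have "istopology ?P"
    unfolding istopology_def
  proof (intro conjI allI impI)
    fix S T assume "?P S" "?P T"
    moreover have "{x \<in> topspace (X i). f i x \<in> S \<inter> T} =
      {x \<in> topspace (X i). f i x \<in> S} \<inter> {x \<in> topspace (X i). f i x \<in> T}" for i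
      by auto
    ultimately show "S \<inter> T \<subseteq> Y" "\<forall>i\<in>I. openin (X i) {x \<in> topspace (X i). f i x \<in> S \<inter> T}"
      by auto
  next
    fix \<K> assume K: "\<forall>K\<in>\<K>. ?P K"
    moreover have "{x \<in> topspace (X i). f i x \<in> \<Union>\<K>} =
      \<Union>((\<lambda>K. {x \<in> topspace (X i). f i x \<in> K}) ` \<K>)" for i
      by auto
    ultimately show "\<Union>\<K> \<subseteq> Y" "\<forall>i\<in>I. openin (X i) {x \<in> topspace (X i). f i x \<in> \<Union>\<K>}"
      by auto
  qed
  then show ?thesis
    by (simp add: final_topology_def)
qed

lemma topspace_final_topology:
  assumes "\<And>i. i \<in> I \<Longrightarrow> f i ` topspace (X i) \<subseteq> Y"
  shows "topspace (final_topology Y I X f) = Y"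
proof
  show "topspace (final_topology Y I X f) \<subseteq> Y"
    by (auto simp: topspace_def openin_final_topology)
  have "openin (X i) {x \<in> topspace (X i). f i x \<in> Y}" if "i \<in> I" for i
  proof -
    have "{x \<in> topspace (X i). f i x \<in> Y} = topspace (X i)"
      using assms[OF that] by auto
    then show ?thesis by simp
  qed
  then have "openin (final_topology Y I X f) Y"
    by (simp add: openin_final_topology)
  then show "Y \<subseteq> topspace (final_topology Y I X f)"
    by (rule openin_subset)
qed

lemma continuous_map_final_topology:
  assumes "\<And>i. i \<in> I \<Longrightarrow> f i ` topspace (X i) \<subseteq> Y" and "i \<in> I"
  shows "continuous_map (X i) (final_topology Y I X f) (f i)"
  using assms
  by (auto simp: continuous_map_def topspace_final_topology openin_final_topology)

lemma final_topology_finest: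
  assumes "topspace T = Y" and "\<And>i. i \<in> I \<Longrightarrow> continuous_map (X i) T (f i)" and "openin T U"
  shows "openin (final_topology Y I X f) U"
  using assms openin_subset[OF assms(3)]
  by (auto simp: openin_final_topology intro: openin_continuous_map_preimage)

definition Ran :: "'a topology \<Rightarrow> 'a set set" where
  "Ran M = {S. S \<subseteq> topspace M \<and> finite S \<and> S \<noteq> {}}"

definition Ran_fin :: "'a topology \<Rightarrow> 'a set topology" where
  "Ran_fin M = final_topology (Ran M) {1::nat..}
     (\<lambda>n. product_topology (\<lambda>_. M) {..<n}) (\<lambda>n x. x ` {..<n})"

lemma topspace_Ran_fin: "topspace (Ran_fin M) = Ran M"
  unfolding Ran_fin_def
proof (rule topspace_final_topology)
  fix n :: nat assume "n \<in> {1..}"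
  then have "{..<n} \<noteq> {}"
    by (auto simp: lessThan_empty_iff)
  then show "(\<lambda>x. x ` {..<n}) ` topspace (product_topology (\<lambda>_. M) {..<n}) \<subseteq> Ran M"
    by (auto simp: Ran_def PiE_def Pi_def)
qed

definition Alexandrov :: "'p::order set \<Rightarrow> 'p topology" where
  "Alexandrov P = topology (\<lambda>U. U \<subseteq> P \<and> (\<forall>p\<in>U. \<forall>q\<in>P. p \<le> q \<longrightarrow> q \<in> U))"

lemma openin_Alexandrov:
  "openin (Alexandrov P) U \<longleftrightarrow> U \<subseteq> P \<and> (\<forall>p\<in>U. \<forall>q\<in>P. p \<le> q \<longrightarrow> q \<in> U)"
proof -
  have "istopology (\<lambda>U. U \<subseteq> P \<and> (\<forall>p\<in>U. \<forall>q\<in>P. p \<le> q \<longrightarrow> q \<in> U))"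
    unfolding istopology_def by blast
  then show ?thesis
    by (simp add: Alexandrov_def)
qed

definition stratified_space :: "'p::order set \<Rightarrow> 'a topology \<Rightarrow> ('a \<Rightarrow> 'p) \<Rightarrow> bool" where
  "stratified_space P T s \<longleftrightarrow> continuous_map T (Alexandrov P) s"

definition stratified_homeomorphism ::
    "'a topology \<Rightarrow> ('a \<Rightarrow> 'p) \<Rightarrow> 'b topology \<Rightarrow> ('b \<Rightarrow> 'p) \<Rightarrow> ('a \<Rightarrow> 'b) \<Rightarrow> bool" where
  "stratified_homeomorphism T s T' s' h \<longleftrightarrow>
     homeomorphic_map T T' h \<and> (\<forall>x \<in> topspace T. s' (h x) = s x)"

text \<open>
  The quotient \<open>X / A\<close> with the quotient topology.  The point \<open>A\<close> is \<open>None\<close>, which is present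
  even if \<open>A = {}\<close>; hence the cone on the empty space is a point.
\<close>

definition collapse :: "'a topology \<Rightarrow> 'a set \<Rightarrow> 'a option topology" where
  "collapse X A = final_topology (insert None (Some ` (topspace X - A))) {()}
     (\<lambda>_. X) (\<lambda>_ x. if x \<in> A then None else Some x)"

lemma topspace_collapse: "topspace (collapse X A) = insert None (Some ` (topspace X - A))"
  unfolding collapse_def by (rule topspace_final_topology) auto

definition open_cone :: "'a topology \<Rightarrow> ('a \<times> real) option topology" where
  "open_cone L = collapse (prod_topology L (top_of_set {0..<1})) (topspace L \<times> {0})"

definition cone_strat :: "'p \<Rightarrow> ('a \<Rightarrow> 'p) \<Rightarrow> ('a \<times> real) option \<Rightarrow> 'p" where
  "cone_strat p s z = (case z of None \<Rightarrow> p | Some (x, t) \<Rightarrow> s x)"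

text \<open>
  Letting \<open>L\<close> range over topologies on the type of the points of \<open>T\<close> is no restriction: the
  image of \<open>L\<close> under \<open>x \<mapsto> (e, [(x, 1/2)])\<close>, for a fixed \<open>e\<close>, is transported by the
  homeomorphism to a subspace of \<open>U\<close> homeomorphic to \<open>L\<close>.
\<close>

definition naively_conical :: "'p::order set \<Rightarrow> 'a topology \<Rightarrow> ('a \<Rightarrow> 'p) \<Rightarrow> bool" where
  "naively_conical P T s \<longleftrightarrow>
     stratified_space P T s \<and>
     (\<forall>x \<in> topspace T. \<exists>U k (L :: 'a topology) sL h.
        neighbourhood_of T x U \<and>
        stratified_space {p \<in> P. s x < p} L sL \<and>
        stratified_homeomorphism (subtopology T U) s
          (prod_topology (Euclidean_space k) (open_cone L)) (\<lambda>z. cone_strat (s x) sL (snd z)) h)"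

end

theory Submission
  imports Defs
begin

text \<open>
  Choose pairwise disjoint Euclidean charts around the \<open>n\<close> points of \<open>X\<close>, and let \<open>U\<close> be the set of
  all finite sets that lie in the union of these charts and meet each of them.  In each chart, a
  set \<open>S \<in> U\<close> has a bounding box.  The midpoints of the \<open>n\<close> boxes form a point of a Euclidean
  space, the \<^emph>\<open>center\<close> of \<open>S\<close>, and the sum of all side lengths is the \<^emph>\<open>spread\<close> of \<open>S\<close>.
  Translations and dilations in the charts act on \<open>U\<close> and change center and spread in the
  obvious way.  If the spread is zero, then \<open>S\<close> has one point in each chart and is determined by its
  center; otherwise \<open>S\<close> is determined by its center, its spread and the set that arises when center
  and spread are normalized to \<open>0\<close> and \<open>1\<close>.  The normalized sets form the link \<open>L\<close>, and \<open>U\<close>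
  is in bijection with the product of the Euclidean space and the cone on \<open>L\<close>.  The cone points
  are the sets of spread zero, which are exactly the elements of \<open>U\<close> with \<open>n\<close> elements; all
  other points of \<open>U\<close> have more elements, and dilations by positive factors keep their number.
  (Barycenters could not replace midpoints of bounding boxes: the barycenter jumps when two points
  of a three-point set collide.)

  Continuity has a different reason in each direction.  For the map from the cone to \<open>U\<close>, it is
  enough that the affine maps act continuously on the charts: Euclidean spaces are locally compact, so a
  map on the product of such a space with a space carrying a final topology can be tested on the maps
  that define the topology (\<open>continuous_map_prod_final_topology\<close>).  This is used once for the
  Ran space and once for the cone.

  For the map from \<open>U\<close> to the cone, the difficulty is the cone point: since \<open>L\<close> need not be compact,
  a neighbourhood of the cone point in the quotient topology may become arbitrarily thin along \<open>L\<close>.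
  However, the final topology on the Ran space only asks for continuity on the tuples of each
  fixed length \<open>m\<close>, and the elements of \<open>L\<close> that come from \<open>m\<close>-tuples form a compact set
  (\<open>compactin_link_tuples\<close>), over which the neighbourhood contains a collar of constant height
  (\<open>collar_around_cone_point\<close>).
\<close>

section \<open>Continuity and final topologies\<close>

lemma continuous_map_from_final_topology:
  assumes f: "\<And>i. i \<in> I \<Longrightarrow> f i ` topspace (X i) \<subseteq> Y"
    and h: "h \<in> Y \<rightarrow> topspace Z"
    and cont: "\<And>i. i \<in> I \<Longrightarrow> continuous_map (X i) Z (\<lambda>x. h (f i x))"
  shows "continuous_map (final_topology Y I X f) Z h"
proof -
  have top: "topspace (final_topology Y I X f) = Y"
    using f by (rule topspace_final_topology)
  have "openin (final_topology Y I X f) {y \<in> Y. h y \<in> V}" if V: "openin Z V" for V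
    unfolding openin_final_topology
  proof (intro conjI ballI)
    fix i assume i: "i \<in> I"
    have "{x \<in> topspace (X i). f i x \<in> {y \<in> Y. h y \<in> V}} = {x \<in> topspace (X i). h (f i x) \<in> V}"
      using f[OF i] by auto
    then show "openin (X i) {x \<in> topspace (X i). f i x \<in> {y \<in> Y. h y \<in> V}}"
      using openin_continuous_map_preimage[OF cont[OF i] V] by simp
  qed auto
  with h show ?thesis
    by (auto simp: continuous_map_def top)
qed

text \<open>
  Given a value in an open set at \<open>(e, y)\<close>, the slice at \<open>y\<close> provides a compact neighbourhood \<open>K\<close> of
  \<open>e\<close> on which the map still takes values there, and the set of all \<open>y'\<close> with this property for
  all of \<open>K\<close> is open by the tube lemma.  The assumption on slices is there for the points of \<open>Y\<close>
  outside all images, such as the apex of the cone on the empty space.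
\<close>

lemma continuous_map_prod_final_topology:
  assumes E: "neighbourhood_base_of (compactin E) E"
    and f: "\<And>i. i \<in> I \<Longrightarrow> f i ` topspace (X i) \<subseteq> Y"
    and slice: "\<And>y. y \<in> Y \<Longrightarrow> continuous_map E Z (\<lambda>e. h (e, y))"
    and cont: "\<And>i. i \<in> I \<Longrightarrow> continuous_map (prod_topology E (X i)) Z (\<lambda>(e, x). h (e, f i x))"
  shows "continuous_map (prod_topology E (final_topology Y I X f)) Z h"
proof -
  let ?Y = "final_topology Y I X f"
  have top: "topspace ?Y = Y"
    using f by (rule topspace_final_topology)
  have hZ: "h (e, y) \<in> topspace Z" if "e \<in> topspace E" "y \<in> Y" for e y
    using slice[OF that(2)] that(1) by (auto simp: continuous_map_def)
  have "openin (prod_topology E ?Y) {p \<in> topspace (prod_topology E ?Y). h p \<in> V}"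
    if V: "openin Z V" for V
    unfolding openin_prod_topology_alt
  proof (intro allI impI)
    fix e y assume "(e, y) \<in> {p \<in> topspace (prod_topology E ?Y). h p \<in> V}"
    then have e: "e \<in> topspace E" and y: "y \<in> Y" and hV: "h (e, y) \<in> V"
      by (auto simp: top)
    have "openin E {e' \<in> topspace E. h (e', y) \<in> V}"
      using slice[OF y] V by (rule openin_continuous_map_preimage)
    then obtain A K where A: "openin E A" and K: "compactin E K" and eA: "e \<in> A"
      and AK: "A \<subseteq> K" and KV: "K \<subseteq> {e' \<in> topspace E. h (e', y) \<in> V}"
      using E e hV unfolding neighbourhood_base_of
      by (smt (verit) mem_Collect_eq)
    let ?B = "{y' \<in> Y. \<forall>e'\<in>K. h (e', y') \<in> V}"
    \<comment> \<open>Compactness of \<open>K\<close> makes the pullback of \<open>?B\<close> open, by the tube lemma.\<close>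
    have "openin ?Y ?B"
      unfolding openin_final_topology
    proof (intro conjI ballI)
      fix i assume i: "i \<in> I"
      let ?W = "{p \<in> topspace (prod_topology E (X i)). (case p of (e, x) \<Rightarrow> h (e, f i x)) \<in> V}"
      have W: "openin (prod_topology E (X i)) ?W"
        using cont[OF i] V by (rule openin_continuous_map_preimage)
      show "openin (X i) {x \<in> topspace (X i). f i x \<in> ?B}"
      proof (subst openin_subopen, intro ballI)
        fix x assume x: "x \<in> {x \<in> topspace (X i). f i x \<in> ?B}"
        then have "K \<times> {x} \<subseteq> ?W"
          using compactin_subset_topspace[OF K] by auto
        then obtain O1 O2 where O: "openin E O1" "openin (X i) O2" "K \<subseteq> O1" "x \<in> O2" "O1 \<times> O2 \<subseteq> ?W"
          using tube_lemma_left[OF W K, of x] x by auto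
        have "O2 \<subseteq> {x \<in> topspace (X i). f i x \<in> ?B}"
        proof
          fix z assume z: "z \<in> O2"
          then have zX: "z \<in> topspace (X i)"
            using openin_subset[OF O(2)] by blast
          moreover have "h (e', f i z) \<in> V" if "e' \<in> K" for e'
          proof -
            have "(e', z) \<in> ?W"
              using O(3,5) z that by blast
            then show ?thesis
              by simp
          qed
          ultimately show "z \<in> {x \<in> topspace (X i). f i x \<in> ?B}"
            using f[OF i] by auto
        qed
        then show "\<exists>T. openin (X i) T \<and> x \<in> T \<and> T \<subseteq> {x \<in> topspace (X i). f i x \<in> ?B}"
          using O by blast
      qed
    qed auto
    moreover have "y \<in> ?B"
      using y KV by auto
    moreover have "A \<times> ?B \<subseteq> {p \<in> topspace (prod_topology E ?Y). h p \<in> V}"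
      using AK openin_subset[OF A] by (auto simp: top)
    ultimately show "\<exists>U' V'. openin E U' \<and> openin ?Y V' \<and> e \<in> U' \<and> y \<in> V' \<and>
        U' \<times> V' \<subseteq> {p \<in> topspace (prod_topology E ?Y). h p \<in> V}"
      using A eA by blast
  qed
  then show ?thesis
    using hZ by (auto simp: continuous_map_def top)
qed

lemma continuous_map_locally:
  assumes "\<And>x. x \<in> topspace X \<Longrightarrow>
    \<exists>A g. openin X A \<and> x \<in> A \<and> continuous_map (subtopology X A) Y g \<and> (\<forall>a\<in>A. f a = g a)"
  shows "continuous_map X Y f"
proof -
  from assms obtain A g where A: "\<And>x. x \<in> topspace X \<Longrightarrow> openin X (A x) \<and> x \<in> A x \<and>
      continuous_map (subtopology X (A x)) Y (g x) \<and> (\<forall>a\<in>A x. f a = g x a)"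
    by metis
  show ?thesis
  proof (rule pasting_lemma[where I = "topspace X" and T = A and f = g])
    show "g i x = g j x" if "i \<in> topspace X" "j \<in> topspace X" "x \<in> topspace X \<inter> A i \<inter> A j" for i j x
      using that A by (metis IntD1 IntD2)
  qed (use A in auto)
qed

lemma continuous_map_compose_real:
  assumes "continuous_map X euclideanreal f" "continuous_on S \<phi>" "\<And>x. x \<in> topspace X \<Longrightarrow> f x \<in> S"
  shows "continuous_map X euclideanreal (\<lambda>x. \<phi> (f x))"
proof -
  have "continuous_map X (top_of_set S) f"
    using assms by (auto simp: continuous_map_in_subtopology)
  moreover have "continuous_map (top_of_set S) euclideanreal \<phi>"
    using assms(2) by simp
  ultimately show ?thesis
    using continuous_map_compose[of X "top_of_set S" f euclideanreal \<phi>] by (simp add: o_def)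
qed

lemma continuous_map_Euclidean_coordinate:
  "continuous_map (Euclidean_space d) euclideanreal (\<lambda>v. v j)"
  unfolding Euclidean_space_def
  by (intro continuous_map_from_subtopology continuous_map_product_projection) auto

section \<open>The Ran space with the final topology\<close>

abbreviation tuples :: "'a topology \<Rightarrow> nat \<Rightarrow> (nat \<Rightarrow> 'a) topology" where
  "tuples M n \<equiv> product_topology (\<lambda>_. M) {..<n}"

lemma openin_Ran_fin:
  "openin (Ran_fin M) U \<longleftrightarrow>
    U \<subseteq> Ran M \<and> (\<forall>n\<ge>1. openin (tuples M n) {x \<in> topspace (tuples M n). x ` {..<n} \<in> U})"
  unfolding Ran_fin_def openin_final_topology by auto

lemma image_tuple_in_Ran:
  assumes "1 \<le> n" "x \<in> topspace (tuples M n)"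
  shows "x ` {..<n} \<in> Ran M"
proof -
  have "{..<n} \<noteq> {}"
    using assms(1) by (auto simp: lessThan_empty_iff)
  then show ?thesis
    using assms(2) by (auto simp: Ran_def PiE_def Pi_def)
qed

lemma continuous_map_image_tuple:
  assumes "1 \<le> n"
  shows "continuous_map (tuples M n) (Ran_fin M) (\<lambda>x. x ` {..<n})"
  unfolding Ran_fin_def
  by (rule continuous_map_final_topology) (use assms image_tuple_in_Ran in auto)

lemma continuous_map_from_Ran_fin:
  assumes "h \<in> Ran M \<rightarrow> topspace Z"
    and "\<And>n. 1 \<le> n \<Longrightarrow> continuous_map (tuples M n) Z (\<lambda>x. h (x ` {..<n}))"
  shows "continuous_map (Ran_fin M) Z h"
  unfolding Ran_fin_def
proof (rule continuous_map_from_final_topology)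
  show "(\<lambda>x. x ` {..<n}) ` topspace (tuples M n) \<subseteq> Ran M" if "n \<in> {1..}" for n
    using image_tuple_in_Ran that by (metis atLeast_iff image_subsetI)
qed (use assms in auto)

lemma Ran_as_tuple:
  assumes "S \<in> Ran M"
  obtains x where "1 \<le> card S" "x \<in> topspace (tuples M (card S))" "x ` {..<card S} = S"
proof -
  have S: "finite S" "S \<noteq> {}" "S \<subseteq> topspace M"
    using assms by (auto simp: Ran_def)
  then obtain f where f: "bij_betw f {..<card S} S"
    using ex_bij_betw_nat_finite[of S] by (auto simp: atLeast0LessThan)
  let ?x = "restrict f {..<card S}"
  have "?x \<in> topspace (tuples M (card S))"
    using f S(3) by (auto simp: bij_betw_def)
  moreover have "?x ` {..<card S} = S"
    using f by (simp add: bij_betw_def)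
  moreover have "1 \<le> card S"
    using S by (simp add: Suc_leI card_gt_0_iff)
  ultimately show ?thesis
    using that by blast
qed

text \<open>
  A continuous family of self-maps of \<open>M\<close> acts continuously on finite subsets, because it does so on
  tuples.
\<close>

lemma continuous_map_Ran_fin_family:
  assumes P: "neighbourhood_base_of (compactin P) P"
    and a: "continuous_map (prod_topology P M) M (\<lambda>(p, x). a p x)"
  shows "continuous_map (prod_topology P (Ran_fin M)) (Ran_fin M) (\<lambda>(p, S). a p ` S)"
proof -
  have tup: "continuous_map (prod_topology P (tuples M n)) (Ran_fin M) (\<lambda>(p, x). a p ` x ` {..<n})"
    if n: "1 \<le> n" for n
  proof -
    have "continuous_map (prod_topology P (tuples M n)) (tuples M n)
        (\<lambda>(p, x). \<lambda>i\<in>{..<n}. a p (x i))"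
      unfolding continuous_map_componentwise
    proof (intro conjI ballI)
      fix i assume i: "i \<in> {..<n}"
      have "continuous_map (prod_topology P (tuples M n)) (prod_topology P M) (\<lambda>z. (fst z, snd z i))"
        by (intro continuous_intros continuous_map_fst
            continuous_map_compose[OF continuous_map_snd continuous_map_product_projection[OF i],
              unfolded o_def])
      from continuous_map_compose[OF this a]
      have "continuous_map (prod_topology P (tuples M n)) M (\<lambda>z. a (fst z) (snd z i))"
        by (simp add: o_def)
      then show "continuous_map (prod_topology P (tuples M n)) M
          (\<lambda>z. (case z of (p, x) \<Rightarrow> \<lambda>i\<in>{..<n}. a p (x i)) i)"
        using i by (simp add: case_prod_unfold)
    qed auto
    from continuous_map_compose[OF this continuous_map_image_tuple[OF n]]
    show ?thesis
      by (simp add: o_def case_prod_unfold image_image)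
  qed
  have slice: "continuous_map P (Ran_fin M) (\<lambda>p. a p ` S)" if S: "S \<in> Ran M" for S
  proof -
    obtain x where x: "1 \<le> card S" "x \<in> topspace (tuples M (card S))" "x ` {..<card S} = S"
      using Ran_as_tuple[OF S] by metis
    have "continuous_map P (prod_topology P (tuples M (card S))) (\<lambda>p. (p, x))"
      using x(2) by (intro continuous_intros) auto
    from continuous_map_compose[OF this tup[OF x(1)]]
    show ?thesis
      by (simp add: o_def x(3))
  qed
  show ?thesis
    unfolding Ran_fin_def
  proof (rule continuous_map_prod_final_topology[OF P])
    show "(\<lambda>x. x ` {..<n}) ` topspace (tuples M n) \<subseteq> Ran M" if "n \<in> {1..}" for n
      using image_tuple_in_Ran that by (metis atLeast_iff image_subsetI)
  qed (use tup slice in \<open>auto simp: Ran_fin_def case_prod_unfold\<close>)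
qed

text \<open>
  Taking a maximum is insensitive to repetitions, so on tuples this is a maximum of finitely many
  continuous functions.
\<close>

lemma continuous_map_Max_Ran_fin:
  fixes f :: "'a \<Rightarrow> real"
  assumes f: "continuous_map M euclideanreal f"
  shows "continuous_map (Ran_fin M) euclideanreal (\<lambda>S. Max (f ` S))"
proof (rule continuous_map_from_Ran_fin)
  fix n :: nat assume "1 \<le> n"
  then obtain m where n: "n = Suc m"
    by (metis Suc_le_D One_nat_def)
  have "continuous_map (tuples M n) euclideanreal (\<lambda>x. Max (f ` x ` {..<Suc k}))" if "k < n" for k
    using that
  proof (induction k)
    case 0
    then show ?case
      using continuous_map_compose[OF continuous_map_product_projection[of 0 "{..<n}" "\<lambda>_. M"] f]
      by (simp add: o_def lessThan_Suc)
  next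
    case (Suc k)
    have "continuous_map (tuples M n) euclideanreal (\<lambda>x. f (x (Suc k)))"
      using continuous_map_compose[OF continuous_map_product_projection[of "Suc k" "{..<n}" "\<lambda>_. M"] f] Suc.prems
      by (simp add: o_def)
    moreover have "Max (f ` x ` {..<Suc (Suc k)}) = max (f (x (Suc k))) (Max (f ` x ` {..<Suc k}))" for x
      by (subst lessThan_Suc) (simp add: Max_insert lessThan_empty_iff)
    ultimately show ?case
      using Suc by (simp add: continuous_map_real_max)
  qed
  from this[of m] show "continuous_map (tuples M n) euclideanreal (\<lambda>x. Max (f ` x ` {..<n}))"
    by (simp add: n)
qed auto

lemma Ran_subtopology: "Ran (subtopology M W) = {S \<in> Ran M. S \<subseteq> W}"
  by (auto simp: Ran_def)

text \<open>
  This allows the passage from \<open>M\<close> to a union of charts.  It holds because the tuples with entries in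
  \<open>W\<close> form an open set, so that openness of a set of such tuples means the same in \<open>W\<close> as in \<open>M\<close>.
\<close>

lemma Ran_fin_open_subspace:
  assumes W: "openin M W"
  shows "openin (Ran_fin M) (Ran (subtopology M W))"
    and "subtopology (Ran_fin M) (Ran (subtopology M W)) = Ran_fin (subtopology M W)"
proof -
  have WM: "W \<subseteq> topspace M"
    using W by (rule openin_subset)
  have tup: "tuples (subtopology M W) n = subtopology (tuples M n) ({..<n} \<rightarrow>\<^sub>E W)" for n
    by (simp add: subtopology_product_topology)
  have opn: "openin (tuples M n) ({..<n} \<rightarrow>\<^sub>E W)" for n
    using W by (simp add: openin_PiE_gen)
  have pre: "{x \<in> topspace (tuples (subtopology M W) n). x ` {..<n} \<in> O'}
       = {x \<in> topspace (tuples M n). x ` {..<n} \<in> O'}"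
    if "O' \<subseteq> Ran (subtopology M W)" for n O'
    using that WM by (fastforce simp: Ran_def PiE_iff)
  have iff: "openin (Ran_fin (subtopology M W)) O' \<longleftrightarrow>
      O' \<subseteq> Ran (subtopology M W) \<and> openin (Ran_fin M) O'" for O'
  proof (cases "O' \<subseteq> Ran (subtopology M W)")
    case True
    have "{x \<in> topspace (tuples M n). x ` {..<n} \<in> O'} \<subseteq> {..<n} \<rightarrow>\<^sub>E W" for n
    proof
      fix x assume x: "x \<in> {x \<in> topspace (tuples M n). x ` {..<n} \<in> O'}"
      then have "x ` {..<n} \<in> Ran (subtopology M W)"
        using True by blast
      then have "x ` {..<n} \<subseteq> W"
        by (simp add: Ran_def)
      then show "x \<in> {..<n} \<rightarrow>\<^sub>E W"
        using x by (simp add: PiE_iff image_subset_iff)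
    qed
    then have "openin (tuples (subtopology M W) n) {x \<in> topspace (tuples M n). x ` {..<n} \<in> O'} \<longleftrightarrow>
        openin (tuples M n) {x \<in> topspace (tuples M n). x ` {..<n} \<in> O'}" for n
      unfolding tup openin_open_subtopology[OF opn] by blast
    then show ?thesis
      using True unfolding openin_Ran_fin pre[OF True] by (auto simp: Ran_subtopology)
  qed (auto simp: openin_Ran_fin)
  show o: "openin (Ran_fin M) (Ran (subtopology M W))"
    using iff[of "Ran (subtopology M W)"] openin_topspace[of "Ran_fin (subtopology M W)"]
    by (simp add: topspace_Ran_fin)
  show "subtopology (Ran_fin M) (Ran (subtopology M W)) = Ran_fin (subtopology M W)"
    unfolding topology_eq by (auto simp: openin_open_subtopology[OF o] iff)
qed

lemma openin_inequality_set:
  assumes "Hausdorff_space Y" "continuous_map X Y f" "continuous_map X Y g"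
  shows "openin X {x \<in> topspace X. f x \<noteq> g x}"
proof -
  have "closedin (prod_topology Y Y) ((\<lambda>y. (y, y)) ` topspace Y)"
    using assms(1) by (simp add: Hausdorff_space_closedin_diagonal)
  then have "openin (prod_topology Y Y) (topspace (prod_topology Y Y) - (\<lambda>y. (y, y)) ` topspace Y)"
    by blast
  moreover have "continuous_map X (prod_topology Y Y) (\<lambda>x. (f x, g x))"
    using assms by (simp add: continuous_map_paired)
  ultimately have "openin X {x \<in> topspace X. (f x, g x) \<in> topspace (prod_topology Y Y) - (\<lambda>y. (y, y)) ` topspace Y}"
    by (rule openin_continuous_map_preimage[rotated])
  also have "{x \<in> topspace X. (f x, g x) \<in> topspace (prod_topology Y Y) - (\<lambda>y. (y, y)) ` topspace Y}
      = {x \<in> topspace X. f x \<noteq> g x}"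
    using assms(2,3) by (auto simp: continuous_map_def Pi_def)
  finally show ?thesis .
qed

lemma topspace_Alexandrov [simp]: "topspace (Alexandrov P) = P"
  using openin_Alexandrov[of P P] openin_subset[of "Alexandrov P" P]
    openin_subset[OF openin_topspace] openin_Alexandrov[of P "topspace (Alexandrov P)"]
  by blast

text \<open>
  The number of elements can only jump upwards: in a Hausdorff space, distinct entries of a tuple
  stay distinct under small perturbations.
\<close>

lemma stratified_space_card_Ran_fin:
  assumes M: "Hausdorff_space M"
  shows "stratified_space {1..} (Ran_fin M) card"
proof -
  have "openin (Ran_fin M) {S \<in> Ran M. card S \<in> A}" if A: "openin (Alexandrov {1::nat..}) A" for A
    unfolding openin_Ran_fin
  proof (intro conjI allI impI)
    fix n :: nat assume n: "1 \<le> n"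
    show "openin (tuples M n) {x \<in> topspace (tuples M n). x ` {..<n} \<in> {S \<in> Ran M. card S \<in> A}}"
    proof (subst openin_subopen, intro ballI)
      fix x assume x: "x \<in> {x \<in> topspace (tuples M n). x ` {..<n} \<in> {S \<in> Ran M. card S \<in> A}}"
      \<comment> \<open>\<open>T\<close> selects one index for each value of \<open>x\<close>.\<close>
      obtain T where T: "T \<subseteq> {..<n}" "inj_on x T" "x ` T = x ` {..<n}"
        by (metis subset_image_inj order_refl)
      have finT: "finite T"
        using T(1) finite_subset by blast
      let ?I = "{(i, j). i \<in> T \<and> j \<in> T \<and> i \<noteq> j}"
      let ?O = "topspace (tuples M n) \<inter>
        (\<Inter>(i, j)\<in>?I. {y \<in> topspace (tuples M n). y i \<noteq> y j})"
      have "openin (tuples M n) {y \<in> topspace (tuples M n). y i \<noteq> y j}" if "i \<in> T" "j \<in> T" for i j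
        using T(1) that by (intro openin_inequality_set[OF M] continuous_map_product_projection) auto
      moreover have "finite ?I"
        using finT by (rule_tac finite_subset[of _ "T \<times> T"]) auto
      ultimately have "openin (tuples M n) ?O"
        by (intro openin_Int_Inter finite_imageI openin_topspace) auto
      moreover have "x \<in> ?O"
        using x T(2) by (auto simp: inj_on_def)
      moreover have "y \<in> {x \<in> topspace (tuples M n). x ` {..<n} \<in> {S \<in> Ran M. card S \<in> A}}" if y: "y \<in> ?O" for y
      proof -
        have yt: "y \<in> topspace (tuples M n)"
          using y by blast
        have "inj_on y T"
          using y by (auto simp: inj_on_def)
        then have "card (x ` {..<n}) = card (y ` T)"
          using T by (metis card_image)
        also have "\<dots> \<le> card (y ` {..<n})"
          using T(1) by (intro card_mono) auto
        finally have "card (x ` {..<n}) \<le> card (y ` {..<n})" .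
        moreover have "card (x ` {..<n}) \<in> A" "1 \<le> card (x ` {..<n})"
          using x A by (auto simp: openin_Alexandrov)
        ultimately have "card (y ` {..<n}) \<in> A"
          using A unfolding openin_Alexandrov by (metis atLeast_iff order_trans)
        then show ?thesis
          using yt image_tuple_in_Ran[OF n yt] by simp
      qed
      ultimately show "\<exists>T. openin (tuples M n) T \<and> x \<in> T \<and>
          T \<subseteq> {x \<in> topspace (tuples M n). x ` {..<n} \<in> {S \<in> Ran M. card S \<in> A}}"
        by blast
    qed
  qed auto
  moreover have "1 \<le> card S" if "S \<in> Ran M" for S
    using that by (simp add: Ran_def Suc_leI card_gt_0_iff)
  ultimately show ?thesis
    by (auto simp: stratified_space_def continuous_map_def topspace_Ran_fin)
qed

section \<open>Translations and dilations in finitely many disjoint charts\<close>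

text \<open>
  The space is a disjoint union of \<open>n\<close> charts, each homeomorphic to a Euclidean space.  The
  coordinates of all charts are concatenated, so that \<open>Euclidean_space k\<close> is the product of the charts:
  the coordinate \<open>j\<close> belongs to the chart \<open>block j\<close>.  A point \<open>x\<close> in the chart \<open>idx x\<close> has
  the coordinates \<open>\<psi> x\<close>, extended by zero to the other blocks, and the parametrization \<open>g i\<close>
  of the chart \<open>i\<close> reads the coordinates in the block \<open>i\<close> only.
\<close>

locale chart_family =
  fixes M :: "'a topology" and n k :: nat and block :: "nat \<Rightarrow> nat"
    and idx :: "'a \<Rightarrow> nat" and \<psi> :: "'a \<Rightarrow> nat \<Rightarrow> real" and g :: "nat \<Rightarrow> (nat \<Rightarrow> real) \<Rightarrow> 'a"
  assumes n: "1 \<le> n"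
    and block: "j < k \<Longrightarrow> block j < n"
    and idx: "x \<in> topspace M \<Longrightarrow> idx x < n"
    and openin_chart: "openin M {x \<in> topspace M. idx x = i}"
    and continuous_\<psi>: "continuous_map M (Euclidean_space k) \<psi>"
    and continuous_g: "i < n \<Longrightarrow> continuous_map (Euclidean_space k) M (g i)"
    and idx_g: "i < n \<Longrightarrow> v \<in> topspace (Euclidean_space k) \<Longrightarrow> idx (g i v) = i"
    and \<psi>_g: "i < n \<Longrightarrow> v \<in> topspace (Euclidean_space k) \<Longrightarrow>
      \<psi> (g i v) j = (if block j = i then v j else 0)"
    and g_\<psi>: "x \<in> topspace M \<Longrightarrow> g (idx x) (\<psi> x) = x"
begin

abbreviation E :: "(nat \<Rightarrow> real) topology" where
  "E \<equiv> Euclidean_space k"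

lemma g_in: "i < n \<Longrightarrow> v \<in> topspace E \<Longrightarrow> g i v \<in> topspace M"
  using continuous_g by (auto simp: continuous_map_def)

lemma \<psi>_in: "x \<in> topspace M \<Longrightarrow> \<psi> x \<in> topspace E"
  using continuous_\<psi> by (auto simp: continuous_map_def)

lemma continuous_\<psi>_coordinate: "continuous_map M euclideanreal (\<lambda>x. \<psi> x j)"
  using continuous_\<psi> unfolding Euclidean_space_def continuous_map_in_subtopology
  by (simp add: continuous_map_componentwise_UNIV)

lemma \<psi>_outside: "x \<in> topspace M \<Longrightarrow> \<not> (j < k \<and> block j = idx x) \<Longrightarrow> \<psi> x j = 0"
  using \<psi>_in[of x] \<psi>_g[OF idx \<psi>_in, of x x j] g_\<psi>[of x] by (auto simp: topspace_Euclidean_space)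

lemma chart_eqI:
  assumes "x \<in> topspace M" "y \<in> topspace M" "idx x = idx y"
    and "\<And>j. j < k \<Longrightarrow> block j = idx x \<Longrightarrow> \<psi> x j = \<psi> y j"
  shows "x = y"
proof -
  have "\<psi> x j = \<psi> y j" for j
    using assms \<psi>_outside by (cases "j < k \<and> block j = idx x") auto
  then have "\<psi> x = \<psi> y" by auto
  then show ?thesis
    using assms(1-3) g_\<psi> by metis
qed

text \<open>
  The affine map \<open>v \<mapsto> e + t v\<close> in every chart simultaneously, where \<open>p = (e, t)\<close>.
\<close>

definition act :: "(nat \<Rightarrow> real) \<times> real \<Rightarrow> 'a \<Rightarrow> 'a" where
  "act p x = g (idx x) (\<lambda>j. fst p j + snd p * \<psi> x j)"

lemma affine_in:
  "e \<in> topspace E \<Longrightarrow> v \<in> topspace E \<Longrightarrow> (\<lambda>j. e j + t * v j) \<in> topspace E"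
  by (simp add: topspace_Euclidean_space)

lemma
  assumes x: "x \<in> topspace M" and e: "e \<in> topspace E"
  shows act_in: "act (e, t) x \<in> topspace M"
    and idx_act: "idx (act (e, t) x) = idx x"
    and \<psi>_act: "\<psi> (act (e, t) x) j = (if block j = idx x then e j + t * \<psi> x j else 0)"
  using affine_in[OF e \<psi>_in[OF x], of t] x idx[OF x]
  by (simp_all add: act_def g_in idx_g \<psi>_g)

lemma act_act:
  assumes x: "x \<in> topspace M" and e: "e \<in> topspace E" "e' \<in> topspace E"
  shows "act (e, t) (act (e', t') x) = act (\<lambda>j. e j + t * e' j, t * t') x"
  using assms affine_in[OF e, of t]
  by (intro chart_eqI) (auto simp: act_in idx_act \<psi>_act algebra_simps)

lemma zero_in_E: "(\<lambda>_. 0) \<in> topspace E"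
  by (simp add: topspace_Euclidean_space)

lemma act_identity: "x \<in> topspace M \<Longrightarrow> act (\<lambda>_. 0, 1) x = x"
  by (intro chart_eqI) (auto simp: act_in idx_act \<psi>_act zero_in_E)

lemma continuous_map_act:
  "continuous_map (prod_topology (prod_topology E euclideanreal) M) M (\<lambda>(p, x). act p x)"
  (is "continuous_map ?X M _")
proof (rule continuous_map_locally)
  fix z assume z: "z \<in> topspace ?X"
  then have sz: "snd z \<in> topspace M" by auto
  let ?i = "idx (snd z)"
  let ?A = "{z' \<in> topspace ?X. snd z' \<in> {x \<in> topspace M. idx x = ?i}}"
  let ?h = "\<lambda>z'. \<lambda>j. fst (fst z') j + snd (fst z') * \<psi> (snd z') j"
  have A: "openin ?X ?A"
    using continuous_map_snd openin_chart by (rule openin_continuous_map_preimage)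
  have "continuous_map ?X euclideanreal (\<lambda>z'. fst (fst z') j)" for j
    using continuous_map_compose[OF continuous_map_compose[OF continuous_map_fst continuous_map_fst]
          continuous_map_Euclidean_coordinate[of k j],
        of "euclideanreal" M]
    by (simp add: o_def)
  moreover have "continuous_map ?X euclideanreal (\<lambda>z'. snd (fst z'))"
    using continuous_map_compose[OF continuous_map_fst continuous_map_snd, of E euclideanreal M]
    by (simp add: o_def)
  moreover have "continuous_map ?X euclideanreal (\<lambda>z'. \<psi> (snd z') j)" for j
    using continuous_map_compose[OF continuous_map_snd continuous_\<psi>_coordinate[of j],
        of "prod_topology E euclideanreal"]
    by (simp add: o_def)
  ultimately have "continuous_map ?X euclideanreal (\<lambda>z'. ?h z' j)" for j
    by (rule continuous_map_add[OF _ continuous_map_real_mult])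
  then have "continuous_map ?X (powertop_real UNIV) ?h"
    by (simp add: continuous_map_componentwise_UNIV)
  moreover have "?h \<in> topspace ?X \<rightarrow> topspace E"
    using \<psi>_in by (auto simp: affine_in)
  ultimately have h: "continuous_map ?X E ?h"
    by (auto simp: Euclidean_space_def continuous_map_in_subtopology)
  have "continuous_map ?X M (g ?i \<circ> ?h)"
    using h continuous_g[OF idx[OF sz]] by (rule continuous_map_compose)
  then have "continuous_map (subtopology ?X ?A) M (g ?i \<circ> ?h)"
    by (rule continuous_map_from_subtopology)
  moreover have "\<forall>a\<in>?A. (case a of (p, x) \<Rightarrow> act p x) = (g ?i \<circ> ?h) a"
    by (auto simp: act_def)
  moreover have "z \<in> ?A"
    using z sz by auto
  ultimately show "\<exists>A h. openin ?X A \<and> z \<in> A \<and> continuous_map (subtopology ?X A) M h \<and>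
      (\<forall>a\<in>A. (case a of (p, x) \<Rightarrow> act p x) = h a)"
    using A by blast
qed

lemma continuous_map_act_Ran:
  "continuous_map (prod_topology (prod_topology E euclideanreal) (Ran_fin M)) (Ran_fin M)
     (\<lambda>(p, S). act p ` S)"
proof (rule continuous_map_Ran_fin_family[OF _ continuous_map_act])
  have "Hausdorff_space (prod_topology E euclideanreal)"
    by (simp add: Hausdorff_space_prod_topology Hausdorff_Euclidean_space)
  moreover have "locally_compact_space (prod_topology E euclideanreal)"
    by (simp add: locally_compact_space_prod_topology locally_compact_Euclidean_space
        locally_compact_space_euclidean)
  ultimately show "neighbourhood_base_of (compactin (prod_topology E euclideanreal)) (prod_topology E euclideanreal)"
    using locally_compact_space_neighbourhood_base by blast
qed

definition U :: "'a set set" where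
  "U = {S \<in> Ran M. idx ` S = {..<n}}"

lemma
  assumes "S \<in> U"
  shows U_Ran: "S \<in> Ran M" and U_finite: "finite S" and U_sub: "S \<subseteq> topspace M"
    and U_idx: "idx ` S = {..<n}"
  using assms by (auto simp: U_def Ran_def)

lemma topspace_U: "topspace (subtopology (Ran_fin M) U) = U"
  by (auto simp: topspace_Ran_fin U_def)

lemma U_meets: "S \<in> U \<Longrightarrow> i < n \<Longrightarrow> \<exists>x\<in>S. idx x = i"
  using U_idx[of S] by (metis imageE lessThan_iff)

lemma continuous_map_on_chart:
  fixes f :: "'a \<Rightarrow> real"
  assumes "continuous_map M euclideanreal f"
  shows "continuous_map M euclideanreal (\<lambda>x. if idx x = i then f x else c)"
proof (rule continuous_map_locally)
  fix x assume x: "x \<in> topspace M"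
  have "continuous_map M euclideanreal (if idx x = i then f else (\<lambda>_. c))"
    using assms by auto
  then show "\<exists>A h. openin M A \<and> x \<in> A \<and> continuous_map (subtopology M A) euclideanreal h \<and>
      (\<forall>a\<in>A. (if idx a = i then f a else c) = h a)"
    using x openin_chart[of "idx x"]
    by (intro exI[of _ "{y \<in> topspace M. idx y = idx x}"] exI[of _ "if idx x = i then f else (\<lambda>_. c)"])
      (auto intro: continuous_map_from_subtopology)
qed

text \<open>
  \<open>S\<close> meets the chart \<open>i\<close> iff the indicator function of that chart has maximum at least \<open>1/2\<close> on \<open>S\<close>,
  equivalently greater than \<open>1/2\<close>.
\<close>

lemma clopen_U: "openin (Ran_fin M) U" "closedin (Ran_fin M) U"
proof -
  let ?m = "\<lambda>i S. Max ((\<lambda>x. if idx x = i then 1 else 0 :: real) ` S)"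
  have cont: "continuous_map (Ran_fin M) euclideanreal (?m i)" for i
    by (intro continuous_map_Max_Ran_fin continuous_map_on_chart) auto
  have m: "?m i S > 1/2 \<longleftrightarrow> (\<exists>x\<in>S. idx x = i)" "?m i S \<ge> 1/2 \<longleftrightarrow> (\<exists>x\<in>S. idx x = i)"
    if "S \<in> Ran M" for S i
  proof -
    have S: "finite S" "S \<noteq> {}"
      using that by (auto simp: Ran_def)
    show "?m i S > 1/2 \<longleftrightarrow> (\<exists>x\<in>S. idx x = i)"
      using S by (subst Max_gr_iff) (auto simp del: if_image_distrib split: if_splits)
    show "?m i S \<ge> 1/2 \<longleftrightarrow> (\<exists>x\<in>S. idx x = i)"
      using S by (subst Max_ge_iff) (auto simp del: if_image_distrib split: if_splits)
  qed
  have U: "U = {S \<in> Ran M. \<forall>i<n. \<exists>x\<in>S. idx x = i}"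
  proof -
    have "idx ` S = {..<n} \<longleftrightarrow> (\<forall>i<n. \<exists>x\<in>S. idx x = i)" if "S \<in> Ran M" for S
    proof -
      have "idx ` S \<subseteq> {..<n}"
        using that idx by (auto simp: Ran_def)
      then have "idx ` S = {..<n} \<longleftrightarrow> (\<forall>i<n. i \<in> idx ` S)"
        by auto
      then show ?thesis
        by (auto simp: image_iff)
    qed
    then show ?thesis
      unfolding U_def by blast
  qed
  have "{S \<in> topspace (Ran_fin M). ?m i S \<in> {1/2<..}} = {S \<in> Ran M. \<exists>x\<in>S. idx x = i}" for i
    using m by (auto simp: topspace_Ran_fin)
  then have "openin (Ran_fin M) {S \<in> Ran M. \<exists>x\<in>S. idx x = i}" for i
    using openin_continuous_map_preimage[OF cont[of i], of "{1/2<..}"] by simp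
  then have "openin (Ran_fin M) (\<Inter>i\<in>{..<n}. {S \<in> Ran M. \<exists>x\<in>S. idx x = i})"
    using n by (intro openin_INT2) (auto simp: lessThan_empty_iff)
  moreover have *: "(\<Inter>i\<in>{..<n}. {S \<in> Ran M. \<exists>x\<in>S. idx x = i}) = U"
  proof -
    have "S \<in> Ran M" if "S \<in> (\<Inter>i\<in>{..<n}. {S \<in> Ran M. \<exists>x\<in>S. idx x = i})" for S
      using INT_D[OF that, of 0] n by simp
    then show ?thesis
      unfolding U by blast
  qed
  ultimately show "openin (Ran_fin M) U"
    by simp
  have "{S \<in> topspace (Ran_fin M). ?m i S \<in> {1/2..}} = {S \<in> Ran M. \<exists>x\<in>S. idx x = i}" for i
    using m by (auto simp: topspace_Ran_fin)
  then have "closedin (Ran_fin M) {S \<in> Ran M. \<exists>x\<in>S. idx x = i}" for i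
    using closedin_continuous_map_preimage[OF cont[of i], of "{1/2..}"] by simp
  then have "closedin (Ran_fin M) (\<Inter>i\<in>{..<n}. {S \<in> Ran M. \<exists>x\<in>S. idx x = i})"
    using n by (intro closedin_INT) (auto simp: lessThan_empty_iff)
  then show "closedin (Ran_fin M) U"
    using * by simp
qed

lemma act_U:
  assumes "S \<in> U" "e \<in> topspace E"
  shows "act (e, t) ` S \<in> U"
proof -
  have "idx ` act (e, t) ` S = idx ` S"
    using U_sub[OF assms(1)] assms(2) by (force simp: image_image idx_act subset_iff)
  then show ?thesis
    using assms by (auto simp: U_def Ran_def act_in subset_iff)
qed

section \<open>Center and spread of a finite set\<close>

text \<open>
  For \<open>s = 1\<close> and \<open>s = -1\<close>, these are the upper end and the negated lower end of the projection of
  \<open>S\<close> to the \<open>j\<close>-th axis of the chart that this coordinate belongs to.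
\<close>

definition support :: "real \<Rightarrow> nat \<Rightarrow> 'a set \<Rightarrow> real" where
  "support s j S = Max ((\<lambda>x. s * \<psi> x j) ` {x \<in> S. idx x = block j})"

definition center :: "'a set \<Rightarrow> nat \<Rightarrow> real" where
  "center S = (\<lambda>j. if j < k then (support 1 j S - support (-1) j S) / 2 else 0)"

definition spread :: "'a set \<Rightarrow> real" where
  "spread S = (\<Sum>j<k. support 1 j S + support (-1) j S)"

lemma support_ge:
  assumes "S \<in> U" "x \<in> S" "idx x = block j"
  shows "s * \<psi> x j \<le> support s j S"
  unfolding support_def using assms U_finite by (intro Max_ge) auto

lemma support_attained:
  assumes "S \<in> U" "j < k"
  obtains x where "x \<in> S" "idx x = block j" "support s j S = s * \<psi> x j"
proof -
  have "support s j S \<in> (\<lambda>x. s * \<psi> x j) ` {x \<in> S. idx x = block j}"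
    unfolding support_def using assms U_finite U_meets[OF assms(1) block[OF assms(2)]]
    by (intro Max_in) auto
  then show ?thesis
    using that by blast
qed

lemma width_nonneg:
  assumes "S \<in> U" "j < k"
  shows "0 \<le> support 1 j S + support (-1) j S"
proof -
  obtain x where "x \<in> S" "idx x = block j"
    using U_meets[OF assms(1) block[OF assms(2)]] by blast
  then show ?thesis
    using support_ge[OF assms(1), of x j 1] support_ge[OF assms(1), of x j "-1"] by simp
qed

lemma spread_nonneg: "S \<in> U \<Longrightarrow> 0 \<le> spread S"
  unfolding spread_def by (intro sum_nonneg width_nonneg) auto

lemma width_le_spread:
  assumes "S \<in> U" "j < k"
  shows "support 1 j S + support (-1) j S \<le> spread S"
  unfolding spread_def using assms width_nonneg
  by (intro member_le_sum[of j "{..<k}" "\<lambda>j. support 1 j S + support (-1) j S"]) auto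

lemma center_in: "center S \<in> topspace E"
  by (simp add: center_def topspace_Euclidean_space)

lemma distance_to_center_le_spread:
  assumes "S \<in> U" "x \<in> S" "j < k" "block j = idx x"
  shows "\<bar>\<psi> x j - center S j\<bar> \<le> spread S / 2"
  using support_ge[OF assms(1,2), of j 1] support_ge[OF assms(1,2), of j "-1"]
    width_le_spread[OF assms(1,3)] assms(3,4)
  by (simp add: center_def abs_le_iff field_simps)

lemma support_act:
  assumes S: "S \<in> U" and e: "e \<in> topspace E" and t: "0 \<le> t" and j: "j < k"
  shows "support s j (act (e, t) ` S) = s * e j + t * support s j S"
proof -
  let ?T = "{x \<in> S. idx x = block j}"
  have T: "{x \<in> act (e, t) ` S. idx x = block j} = act (e, t) ` ?T"
    using U_sub[OF S] e by (auto simp: idx_act subset_iff)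
  have "(\<lambda>x. s * \<psi> x j) ` act (e, t) ` ?T = (\<lambda>u. s * e j + t * u) ` (\<lambda>x. s * \<psi> x j) ` ?T"
    unfolding image_image using U_sub[OF S] e
    by (intro image_cong) (auto simp: \<psi>_act algebra_simps)
  moreover have "mono (\<lambda>u. s * e j + t * u)"
    using t by (intro monoI add_left_mono mult_left_mono)
  then have "s * e j + t * Max ((\<lambda>x. s * \<psi> x j) ` ?T) = Max ((\<lambda>u. s * e j + t * u) ` (\<lambda>x. s * \<psi> x j) ` ?T)"
    using U_finite[OF S] U_meets[OF S block[OF j]] by (intro mono_Max_commute) auto
  ultimately show ?thesis
    unfolding support_def T by simp
qed

lemma center_act:
  assumes "S \<in> U" "e \<in> topspace E" "0 \<le> t"
  shows "center (act (e, t) ` S) = (\<lambda>j. e j + t * center S j)"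
  using assms(2) by (auto simp: center_def support_act[OF assms] topspace_Euclidean_space field_simps)

lemma spread_act:
  assumes "S \<in> U" "e \<in> topspace E" "0 \<le> t"
  shows "spread (act (e, t) ` S) = t * spread S"
  unfolding spread_def sum_distrib_left
  by (intro sum.cong) (auto simp: support_act[OF assms] algebra_simps)

text \<open>
  Which points of a tuple lie in the chart may vary, so the maximum in the definition of \<open>support\<close> is
  not directly one of a fixed number of functions.  After exponentiation the values in the
  chart become positive, and extending by zero outside the chart does not change the maximum.
\<close>

lemma continuous_map_support:
  assumes j: "j < k"
  shows "continuous_map (subtopology (Ran_fin M) U) euclideanreal (support s j)"
proof -
  let ?f = "\<lambda>x. if idx x = block j then exp (s * \<psi> x j) else 0"
  have "continuous_map M euclideanreal (\<lambda>x. exp (s * \<psi> x j))"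
    by (rule continuous_map_compose_real[where S = UNIV])
      (auto intro!: continuous_intros continuous_map_real_mult_left continuous_\<psi>_coordinate)
  then have "continuous_map (Ran_fin M) euclideanreal (\<lambda>S. Max (?f ` S))"
    by (intro continuous_map_Max_Ran_fin continuous_map_on_chart)
  then have cont: "continuous_map (subtopology (Ran_fin M) U) euclideanreal (\<lambda>S. Max (?f ` S))"
    by (rule continuous_map_from_subtopology)
  have eq: "Max (?f ` S) = exp (support s j S)" if S: "S \<in> U" for S
  proof (rule Max_eqI)
    show "finite (?f ` S)"
      using U_finite[OF S] by simp
    show "y \<le> exp (support s j S)" if "y \<in> ?f ` S" for y
      using that support_ge[OF S] by (auto split: if_splits)
    obtain x where "x \<in> S" "idx x = block j" "support s j S = s * \<psi> x j"
      using support_attained[OF S j] by metis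
    then show "exp (support s j S) \<in> ?f ` S"
      by force
  qed
  have "continuous_map (subtopology (Ran_fin M) U) euclideanreal (\<lambda>S. ln (Max (?f ` S)))"
    by (rule continuous_map_compose_real[OF cont, where S = "{0<..}"])
      (auto intro!: continuous_intros simp: eq topspace_U simp del: topspace_subtopology if_image_distrib)
  then show ?thesis
    by (rule continuous_map_eq) (auto simp: eq topspace_U simp del: topspace_subtopology if_image_distrib)
qed

lemma continuous_map_center: "continuous_map (subtopology (Ran_fin M) U) E center"
proof -
  have "continuous_map (subtopology (Ran_fin M) U) euclideanreal
      (\<lambda>S. (support 1 j S - support (-1) j S) / 2)" if "j < k" for j
    using that by (intro continuous_intros continuous_map_support) auto
  then show ?thesis
    unfolding center_def by (simp add: continuous_map_componentwise_Euclidean_space)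
qed

lemma continuous_map_spread: "continuous_map (subtopology (Ran_fin M) U) euclideanreal spread"
proof -
  have "continuous_map (subtopology (Ran_fin M) U) euclideanreal
      (\<lambda>S. \<Sum>j<k. support 1 j S + support (-1) j S)"
    by (intro continuous_map_sum continuous_map_add continuous_map_support) auto
  then show ?thesis
    unfolding spread_def .
qed

definition points :: "(nat \<Rightarrow> real) \<Rightarrow> 'a set" where
  "points e = (\<lambda>i. g i e) ` {..<n}"

lemma points_U: "e \<in> topspace E \<Longrightarrow> points e \<in> U"
  using n by (auto simp: points_def U_def Ran_def g_in idx_g image_image lessThan_empty_iff)

lemma act_zero:
  assumes S: "S \<in> U" and e: "e \<in> topspace E"
  shows "act (e, 0) ` S = points e"
proof -
  have "act (e, 0) ` S = (\<lambda>i. g i e) ` idx ` S"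
    unfolding image_image by (simp add: act_def)
  then show ?thesis
    by (simp add: points_def U_idx[OF S])
qed

lemma
  assumes e: "e \<in> topspace E"
  shows center_points: "center (points e) = e" and spread_points: "spread (points e) = 0"
  using center_act[OF points_U[OF e] e, of 0] spread_act[OF points_U[OF e] e, of 0]
  by (simp_all add: act_zero[OF points_U[OF e] e])

text \<open>
  If all boxes are degenerate, then each point of \<open>S\<close> has the coordinates of the center, and \<open>S\<close> has
  exactly one point in each chart.
\<close>

lemma spread_zero:
  assumes S: "S \<in> U" and "spread S = 0"
  shows "points (center S) = S"
proof -
  have "g (idx x) (center S) = x" if x: "x \<in> S" for x
  proof (rule chart_eqI)
    have xM: "x \<in> topspace M"
      using U_sub[OF S] x by blast
    then show "g (idx x) (center S) \<in> topspace M" "idx (g (idx x) (center S)) = idx x"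
      by (simp_all add: g_in idx_g idx center_in)
    fix j assume "j < k" "block j = idx (g (idx x) (center S))"
    then have j: "j < k" "block j = idx x"
      using xM by (simp_all add: idx_g idx center_in)
    then show "\<psi> (g (idx x) (center S)) j = \<psi> x j"
      using distance_to_center_le_spread[OF S x j] xM assms(2)
      by (simp add: \<psi>_g idx center_in)
  qed (use U_sub[OF S] x in auto)
  then have "(\<lambda>i. g i (center S)) ` idx ` S = S"
    by (force simp: image_image)
  then show ?thesis
    by (simp add: points_def U_idx[OF S])
qed

lemma card_points: "e \<in> topspace E \<Longrightarrow> card (points e) = n"
  unfolding points_def by (subst card_image) (auto intro!: inj_onI simp: idx_g dest: arg_cong[of _ _ idx])

lemma card_ge: "S \<in> U \<Longrightarrow> n \<le> card S"
  using card_image_le[OF U_finite, of S idx] by (simp add: U_idx)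

lemma card_eq_imp_spread_zero:
  assumes S: "S \<in> U" and "card S = n"
  shows "spread S = 0"
proof -
  have "inj_on idx S"
    using assms by (intro eq_card_imp_inj_on U_finite) (simp_all add: U_idx)
  then have "support 1 j S + support (-1) j S = 0" if j: "j < k" for j
    using support_attained[OF S j, of 1] support_attained[OF S j, of "-1"]
    by (metis add.commute inj_onD mult_1 mult_minus1 add.right_inverse)
  then show ?thesis
    by (simp add: spread_def)
qed

lemma card_act:
  assumes S: "S \<in> U" and e: "e \<in> topspace E" and t: "t \<noteq> 0"
  shows "card (act (e, t) ` S) = card S"
proof (intro card_image inj_onI)
  fix x y assume xy: "x \<in> S" "y \<in> S" "act (e, t) x = act (e, t) y"
  then have M: "x \<in> topspace M" "y \<in> topspace M"
    using U_sub[OF S] by auto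
  have i: "idx x = idx y"
    using xy(3) idx_act[OF M(1) e, of t] idx_act[OF M(2) e, of t] by simp
  then show "x = y"
  proof (intro chart_eqI M)
    fix j assume "block j = idx x"
    then show "\<psi> x j = \<psi> y j"
      using xy(3) \<psi>_act[OF M(1) e, of t j] \<psi>_act[OF M(2) e, of t j] i t by simp
  qed
qed

section \<open>The link and its cone\<close>

definition link :: "'a set set" where
  "link = {S \<in> U. center S = (\<lambda>_. 0) \<and> spread S = 1}"

abbreviation L :: "'a set topology" where
  "L \<equiv> subtopology (Ran_fin M) link"

lemma
  assumes "S \<in> link"
  shows link_U: "S \<in> U" and link_center: "center S = (\<lambda>_. 0)" and link_spread: "spread S = 1"
  using assms by (auto simp: link_def)

lemma topspace_L: "topspace L = link"
  by (auto simp: topspace_Ran_fin link_def U_def)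

lemma closedin_link: "closedin (Ran_fin M) link"
proof -
  have "closedin (subtopology (Ran_fin M) U)
      {S \<in> topspace (subtopology (Ran_fin M) U). center S \<in> {\<lambda>_. 0}}"
    by (rule closedin_continuous_map_preimage[OF continuous_map_center])
      (simp add: closedin_Hausdorff_sing_eq Hausdorff_Euclidean_space zero_in_E)
  moreover have "closedin (subtopology (Ran_fin M) U)
      {S \<in> topspace (subtopology (Ran_fin M) U). spread S \<in> {1}}"
    by (rule closedin_continuous_map_preimage[OF continuous_map_spread]) simp
  ultimately have "closedin (subtopology (Ran_fin M) U)
      ({S \<in> U. center S \<in> {\<lambda>_. 0}} \<inter> {S \<in> U. spread S \<in> {1}})"
    unfolding topspace_U by (rule closedin_Int)
  also have "{S \<in> U. center S \<in> {\<lambda>_. 0}} \<inter> {S \<in> U. spread S \<in> {1}} = link"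
    by (auto simp: link_def)
  finally show ?thesis
    using closedin_closed_subtopology[OF clopen_U(2)] by blast
qed

lemma compactin_cube:
  "compactin E {v \<in> topspace E. \<forall>j. \<bar>v j\<bar> \<le> 1}"
proof -
  have "compactin (powertop_real UNIV) (\<Pi>\<^sub>E j\<in>UNIV. if j < k then {-1..1} else {0})"
    by (simp add: compactin_PiE)
  moreover have "(\<Pi>\<^sub>E j\<in>UNIV. if j < k then {-1..1} else {0::real}) = {v \<in> topspace E. \<forall>j. \<bar>v j\<bar> \<le> 1}"
  proof -
    have "v j \<in> (if j < k then {-1..1} else {0}) \<longleftrightarrow> (k \<le> j \<longrightarrow> v j = 0) \<and> \<bar>v j\<bar> \<le> 1"
      for v :: "nat \<Rightarrow> real" and j
      by auto
    then show ?thesis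
      by (simp add: topspace_Euclidean_space PiE_def Pi_def all_conj_distrib)
  qed
  ultimately show ?thesis
    unfolding Euclidean_space_def by (auto simp: compactin_subtopology)
qed

text \<open>
  Sets in the link have center zero and boxes of side length at most \<open>1\<close>, so the tuples that
  represent them form a closed set of tuples with entries in a compact set.
\<close>

lemma compactin_link_tuples:
  assumes m: "1 \<le> m"
  shows "compactin L ((\<lambda>y. y ` {..<m}) ` {y \<in> topspace (tuples M m). y ` {..<m} \<in> link})"
proof -
  let ?B = "\<Union>i\<in>{..<n}. g i ` {v \<in> topspace E. \<forall>j. \<bar>v j\<bar> \<le> 1}"
  let ?K = "{y \<in> topspace (tuples M m). y ` {..<m} \<in> link}"
  have "compactin M (g i ` {v \<in> topspace E. \<forall>j. \<bar>v j\<bar> \<le> 1})" if "i < n" for i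
    using compactin_cube continuous_g[OF that] by (rule image_compactin)
  then have "compactin M ?B"
    by (intro compactin_Union) auto
  then have "compactin (tuples M m) ({..<m} \<rightarrow>\<^sub>E ?B)"
    by (simp add: compactin_PiE)
  moreover have "closedin (tuples M m) ?K"
    using continuous_map_image_tuple[OF m] closedin_link by (rule closedin_continuous_map_preimage)
  moreover have "?K \<subseteq> {..<m} \<rightarrow>\<^sub>E ?B"
  proof
    fix y assume y: "y \<in> ?K"
    have "y l \<in> ?B" if l: "l < m" for l
    proof -
      have S: "y ` {..<m} \<in> link" and yl: "y l \<in> y ` {..<m}"
        using y l by auto
      have M: "y l \<in> topspace M"
        using U_sub[OF link_U[OF S]] yl by blast
      have "\<bar>\<psi> (y l) j\<bar> \<le> 1" for j
      proof (cases "j < k \<and> block j = idx (y l)")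
        case True
        then show ?thesis
          using distance_to_center_le_spread[OF link_U[OF S] yl] link_center[OF S] link_spread[OF S]
          by force
      qed (use \<psi>_outside[OF M] in simp)
      then show ?thesis
        using g_\<psi>[OF M] \<psi>_in[OF M] idx[OF M] by force
    qed
    then show "y \<in> {..<m} \<rightarrow>\<^sub>E ?B"
      using y by (auto simp: PiE_iff)
  qed
  ultimately have "compactin (tuples M m) ?K"
    using closed_compactin by blast
  then have "compactin (Ran_fin M) ((\<lambda>y. y ` {..<m}) ` ?K)"
    using continuous_map_image_tuple[OF m] by (rule image_compactin)
  then show ?thesis
    by (auto simp: compactin_subtopology)
qed

definition rescale :: "'a set \<Rightarrow> 'a set" where
  "rescale S = act (\<lambda>j. - (center S j / spread S), 1 / spread S) ` S"

text \<open>
  The spread in \<open>[0, \<infinity>)\<close> and the height in \<open>[0, 1)\<close> correspond under \<open>r \<mapsto> r / (1 + r)\<close>, with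
  inverse \<open>t \<mapsto> t / (1 - t)\<close>.
\<close>

definition to_cone :: "'a set \<Rightarrow> ('a set \<times> real) option" where
  "to_cone S = (if spread S = 0 then None else Some (rescale S, spread S / (1 + spread S)))"

definition of_cone :: "(nat \<Rightarrow> real) \<times> ('a set \<times> real) option \<Rightarrow> 'a set" where
  "of_cone p = (case snd p of None \<Rightarrow> points (fst p)
     | Some (S, t) \<Rightarrow> act (fst p, t / (1 - t)) ` S)"

abbreviation cylinder :: "('a set \<times> real) topology" where
  "cylinder \<equiv> prod_topology L (top_of_set {0..<1})"

lemma topspace_cylinder: "topspace cylinder = link \<times> {0..<1}"
  by (simp only: topspace_prod_topology topspace_L) simp

lemma topspace_cone: "topspace (open_cone L) = insert None (Some ` (link \<times> {0<..<1}))"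
proof -
  have "link \<times> {0..<1} - link \<times> {0} = link \<times> {0<..<1::real}"
    by auto
  then show ?thesis
    by (simp only: open_cone_def topspace_collapse topspace_cylinder topspace_L)
qed

lemma openin_cone:
  "openin (open_cone L) W \<longleftrightarrow> W \<subseteq> topspace (open_cone L) \<and>
     openin cylinder {(S, t) \<in> link \<times> {0..<1}. (if t = 0 then None else Some (S, t)) \<in> W}"
proof -
  have "{x \<in> topspace cylinder. (if x \<in> topspace L \<times> {0} then None else Some x) \<in> W}
      = {(S, t) \<in> link \<times> {0..<1}. (if t = 0 then None else Some (S, t)) \<in> W}"
    unfolding topspace_cylinder topspace_L by auto
  then show ?thesis
    unfolding open_cone_def collapse_def openin_final_topology
      topspace_collapse[unfolded collapse_def] by simp
qed

lemma scaled_in_E: "e \<in> topspace E \<Longrightarrow> (\<lambda>j. - (e j / t)) \<in> topspace E"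
  by (simp add: topspace_Euclidean_space)

lemma rescale_link:
  assumes "S \<in> U" "spread S \<noteq> 0"
  shows "rescale S \<in> link"
proof -
  have "0 < spread S"
    using spread_nonneg[OF assms(1)] assms(2) by simp
  then show ?thesis
    using assms unfolding link_def rescale_def
    by (simp add: act_U scaled_in_E center_in center_act spread_act)
qed

lemma rescale_act:
  assumes S: "S \<in> link" and e: "e \<in> topspace E" and t: "0 < t"
  shows "rescale (act (e, t) ` S) = S"
proof -
  have c: "center (act (e, t) ` S) = e" and s: "spread (act (e, t) ` S) = t"
    using t by (simp_all add: center_act spread_act link_U[OF S] link_center[OF S] link_spread[OF S] e)
  have "act (\<lambda>j. - (e j / t), 1 / t) (act (e, t) x) = x" if "x \<in> S" for x
  proof -
    have x: "x \<in> topspace M"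
      using U_sub[OF link_U[OF S]] that by blast
    then show ?thesis
      using act_act[OF x scaled_in_E[OF e] e, of t "1/t" t] act_identity[OF x] t by simp
  qed
  then show ?thesis
    unfolding rescale_def c s by (simp add: image_image)
qed

lemma act_rescale:
  assumes S: "S \<in> U" and s: "spread S \<noteq> 0"
  shows "act (center S, spread S) ` rescale S = S"
proof -
  have "act (center S, spread S) (act (\<lambda>j. - (center S j / spread S), 1 / spread S) x) = x"
    if "x \<in> S" for x
  proof -
    have x: "x \<in> topspace M"
      using U_sub[OF S] that by blast
    then show ?thesis
      using act_act[OF x center_in scaled_in_E[OF center_in], of S "spread S" S "spread S" "1 / spread S"]
        act_identity[OF x] s by simp
  qed
  then show ?thesis
    unfolding rescale_def by (simp add: image_image)
qed

lemma to_cone_in: "S \<in> U \<Longrightarrow> to_cone S \<in> topspace (open_cone L)"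
  using spread_nonneg[of S] by (auto simp: to_cone_def topspace_cone rescale_link)

lemma of_cone_in:
  assumes "e \<in> topspace E" "z \<in> topspace (open_cone L)"
  shows "of_cone (e, z) \<in> U"
  using assms by (auto simp: of_cone_def topspace_cone points_U act_U link_U)

lemma of_cone_to_cone:
  assumes S: "S \<in> U"
  shows "of_cone (center S, to_cone S) = S"
proof (cases "spread S = 0")
  case True
  then show ?thesis
    by (simp add: of_cone_def to_cone_def spread_zero[OF S])
next
  case False
  have "spread S / (1 + spread S) / (1 - spread S / (1 + spread S)) = spread S"
    using spread_nonneg[OF S] by (simp add: field_simps)
  then show ?thesis
    using False by (simp add: of_cone_def to_cone_def act_rescale[OF S])
qed

lemma
  assumes e: "e \<in> topspace E" and z: "z \<in> topspace (open_cone L)"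
  shows center_of_cone: "center (of_cone (e, z)) = e"
    and to_cone_of_cone: "to_cone (of_cone (e, z)) = z"
proof -
  have "center (of_cone (e, z)) = e \<and> to_cone (of_cone (e, z)) = z"
  proof (cases z)
    case None
    then show ?thesis
      by (simp add: of_cone_def to_cone_def center_points spread_points e)
  next
    case (Some p)
    then obtain S t where z': "z = Some (S, t)" and S: "S \<in> link" and t: "0 < t" "t < 1"
      using z by (cases p) (auto simp: topspace_cone)
    have "0 < t / (1 - t)"
      using t by simp
    moreover have "t / (1 - t) / (1 + t / (1 - t)) = t"
      using t by (simp add: field_simps)
    ultimately show ?thesis
      unfolding z' of_cone_def to_cone_def
      using t by (simp add: center_act spread_act link_U[OF S] link_center[OF S] link_spread[OF S] e
          rescale_act[OF S])
  qed
  then show "center (of_cone (e, z)) = e" "to_cone (of_cone (e, z)) = z"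
    by auto
qed

text \<open>
  On the cylinder, the map is \<open>(e, S, t) \<mapsto> e + t / (1 - t) S\<close>, including the height \<open>t = 0\<close>, where the
  result no longer depends on \<open>S\<close>.
\<close>

lemma continuous_map_of_cone:
  "continuous_map (prod_topology E (open_cone L)) (subtopology (Ran_fin M) U) of_cone"
  unfolding continuous_map_in_subtopology
proof
  have nb: "neighbourhood_base_of (compactin E) E"
    using locally_compact_Euclidean_space Hausdorff_Euclidean_space locally_compact_space_neighbourhood_base
    by blast
  have points: "continuous_map E (Ran_fin M) points"
  proof -
    have "continuous_map E (tuples M n) (\<lambda>e. \<lambda>i\<in>{..<n}. g i e)"
      by (auto simp: continuous_map_componentwise continuous_g)
    from continuous_map_compose[OF this continuous_map_image_tuple[OF n]]
    show ?thesis
      unfolding points_def by (simp add: o_def)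
  qed
  have act: "continuous_map (prod_topology E cylinder) (Ran_fin M)
      (\<lambda>(e, S, t). act (e, t / (1 - t)) ` S)"
  proof -
    let ?X = "prod_topology E cylinder"
    have t: "continuous_map ?X (top_of_set {0..<1}) (\<lambda>p. snd (snd p))"
      by (rule continuous_map_compose[OF continuous_map_snd continuous_map_snd, unfolded o_def])
    then have "continuous_map ?X euclideanreal (\<lambda>p. snd (snd p))"
      by (simp add: continuous_map_in_subtopology)
    then have "continuous_map ?X euclideanreal (\<lambda>p. snd (snd p) / (1 - snd (snd p)))"
      by (intro continuous_map_real_divide continuous_map_diff) (auto simp: topspace_cylinder)
    moreover have "continuous_map ?X L (\<lambda>p. fst (snd p))"
      by (rule continuous_map_compose[OF continuous_map_snd continuous_map_fst, unfolded o_def])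
    then have "continuous_map ?X (Ran_fin M) (\<lambda>p. fst (snd p))"
      by (simp only: continuous_map_in_subtopology)
    ultimately have "continuous_map ?X (prod_topology (prod_topology E euclideanreal) (Ran_fin M))
        (\<lambda>p. ((fst p, snd (snd p) / (1 - snd (snd p))), fst (snd p)))"
      by (simp add: continuous_map_paired continuous_map_fst)
    from continuous_map_compose[OF this continuous_map_act_Ran]
    show ?thesis
      by (simp add: o_def case_prod_unfold)
  qed
  show "continuous_map (prod_topology E (open_cone L)) (Ran_fin M) of_cone"
    unfolding open_cone_def collapse_def
  proof (rule continuous_map_prod_final_topology[OF nb])
    fix z assume "z \<in> insert None (Some ` (topspace cylinder - topspace L \<times> {0}))"
    then consider "z = None" | S t where "z = Some (S, t)" "S \<in> link" "0 \<le> t" "t < 1"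
      unfolding topspace_cylinder by auto
    then show "continuous_map E (Ran_fin M) (\<lambda>e. of_cone (e, z))"
    proof cases
      case 1
      then show ?thesis
        using points by (simp add: of_cone_def)
    next
      case 2
      then have "continuous_map E (prod_topology E cylinder) (\<lambda>e. (e, S, t))"
        by (intro continuous_intros) (auto simp: topspace_L simp del: topspace_subtopology)
      from continuous_map_compose[OF this act] show ?thesis
        using 2 by (simp add: of_cone_def o_def)
    qed
  next
    show "continuous_map (prod_topology E cylinder) (Ran_fin M)
      (\<lambda>(e, x). of_cone (e, if x \<in> topspace L \<times> {0} then None else Some x))"
    proof (rule continuous_map_eq[OF act])
      fix p assume "p \<in> topspace (prod_topology E cylinder)"
      then have "p \<in> topspace E \<times> (link \<times> {0..<1})"
        by (simp only: topspace_prod_topology[of E] topspace_cylinder)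
      then obtain e S t where "p = (e, S, t)" "e \<in> topspace E" "S \<in> link" "0 \<le> t" "t < 1"
        by auto
      then show "(case p of (e, S, t) \<Rightarrow> act (e, t / (1 - t)) ` S)
          = (case p of (e, x) \<Rightarrow> of_cone (e, if x \<in> topspace L \<times> {0} then None else Some x))"
        by (auto simp: of_cone_def topspace_L act_zero link_U simp del: topspace_subtopology)
    qed
  qed auto
  show "of_cone \<in> topspace (prod_topology E (open_cone L)) \<rightarrow> U"
    using of_cone_in by auto
qed

lemma continuous_map_to_cylinder:
  "continuous_map (subtopology (Ran_fin M) {S \<in> U. 0 < spread S}) cylinder
     (\<lambda>S. (rescale S, spread S / (1 + spread S)))"
proof -
  let ?X = "subtopology (Ran_fin M) {S \<in> U. 0 < spread S}"
  have X: "?X = subtopology (subtopology (Ran_fin M) U) {S \<in> U. 0 < spread S}"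
    unfolding subtopology_subtopology by (rule arg_cong[of _ _ "subtopology _"]) auto
  have top: "topspace ?X = {S \<in> U. 0 < spread S}"
    by (auto simp: topspace_Ran_fin U_def)
  have spread: "continuous_map ?X euclideanreal spread"
    unfolding X using continuous_map_spread by (rule continuous_map_from_subtopology)
  have center: "continuous_map ?X euclideanreal (\<lambda>S. center S j)" for j
  proof -
    have "continuous_map ?X (powertop_real UNIV) center"
      unfolding X using continuous_map_center
      by (auto simp: Euclidean_space_def continuous_map_in_subtopology intro: continuous_map_from_subtopology)
    then show ?thesis
      by (simp add: continuous_map_componentwise_UNIV)
  qed
  have "continuous_map ?X euclideanreal (\<lambda>S. - (center S j / spread S))" for j
    using center spread by (intro continuous_map_minus continuous_map_real_divide) (auto simp: top)
  then have "continuous_map ?X E (\<lambda>S j. - (center S j / spread S))"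
    by (auto simp: Euclidean_space_def continuous_map_in_subtopology continuous_map_componentwise_UNIV
        center_def)
  moreover have "continuous_map ?X euclideanreal (\<lambda>S. 1 / spread S)"
    using spread by (intro continuous_map_real_divide) (auto simp: top)
  moreover have "continuous_map ?X (Ran_fin M) (\<lambda>S. S)"
    by (simp add: continuous_map_from_subtopology)
  ultimately have "continuous_map ?X (prod_topology (prod_topology E euclideanreal) (Ran_fin M))
      (\<lambda>S. ((\<lambda>j. - (center S j / spread S), 1 / spread S), S))"
    by (simp add: continuous_map_paired)
  from continuous_map_compose[OF this continuous_map_act_Ran]
  have "continuous_map ?X (Ran_fin M) rescale"
    by (simp add: o_def rescale_def[abs_def])
  then have "continuous_map ?X L rescale"
    using rescale_link by (auto simp: continuous_map_in_subtopology)
  moreover have "continuous_map ?X euclideanreal (\<lambda>S. spread S / (1 + spread S))"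
    using spread by (intro continuous_map_real_divide continuous_map_add) (auto simp: top)
  then have "continuous_map ?X (top_of_set {0..<1}) (\<lambda>S. spread S / (1 + spread S))"
    by (auto simp: continuous_map_in_subtopology)
  ultimately show ?thesis
    by (simp add: continuous_map_paired)
qed

lemma openin_spread:
  assumes "open V"
  shows "openin (Ran_fin M) {S \<in> U. spread S \<in> V}"
proof -
  have "openin (subtopology (Ran_fin M) U) {S \<in> topspace (subtopology (Ran_fin M) U). spread S \<in> V}"
    using assms by (intro openin_continuous_map_preimage[OF continuous_map_spread]) simp
  then show ?thesis
    unfolding topspace_U openin_open_subtopology[OF clopen_U(1)] by blast
qed

text \<open>
  The compact part of the link that comes from \<open>m\<close>-tuples, placed at height \<open>0\<close>, has a neighbourhood
  of constant height in the preimage of \<open>W\<close> in the cylinder, by the tube lemma.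
\<close>

lemma collar_around_cone_point:
  assumes W: "openin (open_cone L) W" "None \<in> W" and m: "1 \<le> m"
  shows "\<exists>\<epsilon>>0. \<forall>S \<in> (\<lambda>y. y ` {..<m}) ` {y \<in> topspace (tuples M m). y ` {..<m} \<in> link}.
    \<forall>t. 0 < t \<longrightarrow> t < 1 \<longrightarrow> t < \<epsilon> \<longrightarrow> Some (S, t) \<in> W"
proof -
  let ?C = "(\<lambda>y. y ` {..<m}) ` {y \<in> topspace (tuples M m). y ` {..<m} \<in> link}"
  let ?W = "{(S, t) \<in> link \<times> {0..<1}. (if t = 0 then None else Some (S, t)) \<in> W}"
  have "openin cylinder ?W"
    using W(1) by (simp add: openin_cone)
  moreover have "?C \<times> {0} \<subseteq> ?W"
    using W(2) by auto
  ultimately obtain A V where AV: "openin L A" "openin (top_of_set {0..<1}) V" "?C \<subseteq> A" "0 \<in> V"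
      "A \<times> V \<subseteq> ?W"
    using tube_lemma_left[OF _ compactin_link_tuples[OF m], of "top_of_set {0..<1}" ?W 0] by auto
  from AV(2) have "\<forall>x\<in>V. \<exists>e>0. \<forall>x'\<in>{0..<1}. dist x' x < e \<longrightarrow> x' \<in> V"
    unfolding openin_euclidean_subtopology_iff by blast
  with AV(4) obtain \<epsilon> where \<epsilon>: "0 < \<epsilon>" "\<forall>t\<in>{0..<1}. dist t 0 < \<epsilon> \<longrightarrow> t \<in> V"
    by blast
  show ?thesis
  proof (intro exI conjI ballI allI impI)
    show "0 < \<epsilon>"
      by fact
    fix S t assume "S \<in> ?C" "0 < t" "t < 1" "t < \<epsilon>"
    then have "(S, t) \<in> A \<times> V"
      using AV(3) \<epsilon>(2) by auto
    then show "Some (S, t) \<in> W"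
      using AV(5) \<open>0 < t\<close> by fastforce
  qed
qed

text \<open>
  Away from spread zero this holds because the map lifts to the cylinder.  An open set that contains
  the cone point is handled on \<open>m\<close>-tuples for each \<open>m\<close> separately: there its preimage is the
  union of the preimage on the locus of positive spread and of a locus of small spread.
\<close>

lemma continuous_map_to_cone:
  "continuous_map (subtopology (Ran_fin M) U) (open_cone L) to_cone"
proof -
  have "openin (Ran_fin M) {S \<in> U. to_cone S \<in> W}" if W: "openin (open_cone L) W" for W
  proof -
    let ?O = "{S \<in> U. to_cone S \<in> W}"
    let ?O1 = "{S \<in> U. 0 < spread S \<and> to_cone S \<in> W}"
    have pos: "openin (Ran_fin M) {S \<in> U. 0 < spread S}"
      using openin_spread[of "{0<..}"] by simp
    let ?W = "{(S, t) \<in> link \<times> {0..<1}. (if t = 0 then None else Some (S, t)) \<in> W}"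
    have "openin cylinder ?W"
      using W by (simp add: openin_cone)
    with continuous_map_to_cylinder
    have "openin (subtopology (Ran_fin M) {S \<in> U. 0 < spread S})
      {S \<in> topspace (subtopology (Ran_fin M) {S \<in> U. 0 < spread S}).
        (rescale S, spread S / (1 + spread S)) \<in> ?W}"
      by (rule openin_continuous_map_preimage)
    then have "openin (Ran_fin M)
      {S \<in> topspace (subtopology (Ran_fin M) {S \<in> U. 0 < spread S}).
        (rescale S, spread S / (1 + spread S)) \<in> ?W}"
      using openin_open_subtopology[OF pos] by blast
    moreover have "{S \<in> topspace (subtopology (Ran_fin M) {S \<in> U. 0 < spread S}).
        (rescale S, spread S / (1 + spread S)) \<in> ?W} = ?O1"
      using U_Ran rescale_link by (auto simp: to_cone_def topspace_Ran_fin)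
    ultimately have O1: "openin (Ran_fin M) ?O1"
      by simp
    show ?thesis
    proof (cases "None \<in> W")
      case False
      then have "?O = ?O1"
        using spread_nonneg by (force simp: to_cone_def order_less_le)
      then show ?thesis
        using O1 by simp
    next
      case True
      show ?thesis
        unfolding openin_Ran_fin
      proof (intro conjI allI impI)
        fix m :: nat assume m: "1 \<le> m"
        obtain \<epsilon> where \<epsilon>: "0 < \<epsilon>"
          "\<forall>S \<in> (\<lambda>y. y ` {..<m}) ` {y \<in> topspace (tuples M m). y ` {..<m} \<in> link}.
             \<forall>t. 0 < t \<longrightarrow> t < 1 \<longrightarrow> t < \<epsilon> \<longrightarrow> Some (S, t) \<in> W"
          using collar_around_cone_point[OF W True m] by blast
        \<comment> \<open>The height \<open>r / (1 + r)\<close> is at most the spread \<open>r\<close>, so spread below \<open>\<epsilon>\<close> suffices.\<close>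
        let ?O2 = "{S \<in> U. spread S \<in> {..<\<epsilon>}}"
        have small: "to_cone (y ` {..<m}) \<in> W"
          if y: "y \<in> topspace (tuples M m)" and S: "y ` {..<m} \<in> U" and sp: "spread (y ` {..<m}) < \<epsilon>" for y
        proof (cases "spread (y ` {..<m}) = 0")
          case True
          then show ?thesis
            using \<open>None \<in> W\<close> by (simp add: to_cone_def)
        next
          case False
          let ?S = "y ` {..<m}"
          let ?y = "\<lambda>l\<in>{..<m}. act (\<lambda>j. - (center ?S j / spread ?S), 1 / spread ?S) (y l)"
          have im: "?y ` {..<m} = rescale ?S"
            by (auto simp: rescale_def image_image)
          have "act (\<lambda>j. - (center ?S j / spread ?S), 1 / spread ?S) (y l) \<in> topspace M" if "l < m" for l
            using y that by (intro act_in scaled_in_E center_in) auto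
          then have "?y \<in> topspace (tuples M m)"
            by auto
          moreover have "?y ` {..<m} \<in> link"
            unfolding im using S False by (rule rescale_link)
          ultimately have "rescale ?S \<in> (\<lambda>y. y ` {..<m}) ` {y \<in> topspace (tuples M m). y ` {..<m} \<in> link}"
            using im by (metis (mono_tags, lifting) image_eqI mem_Collect_eq)
          moreover have "0 < spread ?S"
            using False spread_nonneg[OF S] by simp
          moreover from this have "spread ?S / (1 + spread ?S) < 1" "spread ?S / (1 + spread ?S) \<le> spread ?S"
            by (simp_all add: divide_le_eq mult_le_cancel_left1)
          ultimately show ?thesis
            using \<epsilon>(2)[rule_format, of "rescale ?S" "spread ?S / (1 + spread ?S)"] sp False
            by (simp add: to_cone_def)
        qed
        have "openin (Ran_fin M) (?O1 \<union> ?O2)"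
          by (rule openin_Un[OF O1 openin_spread[OF open_lessThan]])
        then have "openin (tuples M m) {y \<in> topspace (tuples M m). y ` {..<m} \<in> ?O1 \<union> ?O2}"
          using m unfolding openin_Ran_fin by blast
        also have "{y \<in> topspace (tuples M m). y ` {..<m} \<in> ?O1 \<union> ?O2} = {y \<in> topspace (tuples M m). y ` {..<m} \<in> ?O}"
        proof (intro Collect_cong conj_cong refl)
          fix y assume y: "y \<in> topspace (tuples M m)"
          have "0 < spread (y ` {..<m}) \<or> spread (y ` {..<m}) < \<epsilon>"
            using \<epsilon>(1) by linarith
          then show "y ` {..<m} \<in> ?O1 \<union> ?O2 \<longleftrightarrow> y ` {..<m} \<in> ?O"
            using small[OF y] by blast
        qed
        finally show "openin (tuples M m) {y \<in> topspace (tuples M m). y ` {..<m} \<in> ?O}" .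
      qed (use U_Ran in auto)
    qed
  qed
  then show ?thesis
    unfolding continuous_map_def topspace_U
    using to_cone_in openin_open_subtopology[OF clopen_U(1)] by auto
qed

lemma stratified_homeomorphism_cone:
  "stratified_homeomorphism (subtopology (Ran_fin M) U) card (prod_topology E (open_cone L))
     (\<lambda>(e, z). cone_strat n card z) (\<lambda>S. (center S, to_cone S))"
  unfolding stratified_homeomorphism_def
proof (intro conjI ballI)
  have "homeomorphic_maps (subtopology (Ran_fin M) U) (prod_topology E (open_cone L))
      (\<lambda>S. (center S, to_cone S)) of_cone"
    unfolding homeomorphic_maps_def topspace_U
  proof (intro conjI ballI)
    show "continuous_map (subtopology (Ran_fin M) U) (prod_topology E (open_cone L))
        (\<lambda>S. (center S, to_cone S))"
      using continuous_map_center continuous_map_to_cone by (simp add: continuous_map_paired)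
  qed (auto simp: continuous_map_of_cone of_cone_to_cone center_of_cone to_cone_of_cone)
  then show "homeomorphic_map (subtopology (Ran_fin M) U) (prod_topology E (open_cone L))
      (\<lambda>S. (center S, to_cone S))"
    using homeomorphic_maps_map by blast
  fix S assume "S \<in> topspace (subtopology (Ran_fin M) U)"
  then have S: "S \<in> U"
    by (simp only: topspace_U)
  show "(case (center S, to_cone S) of (e, z) \<Rightarrow> cone_strat n card z) = card S"
  proof (cases "spread S = 0")
    case True
    then show ?thesis
      using card_points[OF center_in, of S] by (simp add: to_cone_def cone_strat_def spread_zero[OF S])
  next
    case False
    then show ?thesis
      by (simp add: to_cone_def cone_strat_def rescale_def card_act[OF S scaled_in_E[OF center_in]])
  qed
qed

lemma stratified_space_link:
  assumes "Hausdorff_space M"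
  shows "stratified_space {n + 1..} L card"
proof -
  have "continuous_map L (Alexandrov {1..}) card"
    using stratified_space_card_Ran_fin[OF assms] unfolding stratified_space_def
    by (rule continuous_map_from_subtopology)
  moreover have card: "n + 1 \<le> card S" if "S \<in> link" for S
    using card_ge[OF link_U[OF that]] card_eq_imp_spread_zero[OF link_U[OF that]] link_spread[OF that]
    by fastforce
  moreover have "openin (Alexandrov {1..}) A" if "openin (Alexandrov {n + 1..}) A" for A
    using that unfolding openin_Alexandrov by force
  ultimately show ?thesis
    unfolding stratified_space_def continuous_map_def topspace_L by auto
qed

end

section \<open>Charts of a manifold\<close>

definition coordinate_cube :: "nat \<Rightarrow> (nat \<Rightarrow> real) \<Rightarrow> real \<Rightarrow> (nat \<Rightarrow> real) set" where
  "coordinate_cube d p \<delta> = {v \<in> topspace (Euclidean_space d). \<forall>j<d. \<bar>v j - p j\<bar> < \<delta>}"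

lemma openin_coordinate_cube: "openin (Euclidean_space d) (coordinate_cube d p \<delta>)"
proof -
  have "openin (Euclidean_space d) {v \<in> topspace (Euclidean_space d). v j \<in> {x. \<bar>x - p j\<bar> < \<delta>}}" for j
  proof (rule openin_continuous_map_preimage[OF continuous_map_Euclidean_coordinate])
    have "{x. \<bar>x - p j\<bar> < \<delta>} = ball (p j) \<delta>"
      by (auto simp: dist_real_def)
    then show "openin euclideanreal {x. \<bar>x - p j\<bar> < \<delta>}"
      by simp
  qed
  then have "openin (Euclidean_space d)
      ((\<Inter>j\<in>{..<d}. {v \<in> topspace (Euclidean_space d). v j \<in> {x. \<bar>x - p j\<bar> < \<delta>}}) \<inter> topspace (Euclidean_space d))"
    by (intro openin_INT) auto
  also have "(\<Inter>j\<in>{..<d}. {v \<in> topspace (Euclidean_space d). v j \<in> {x. \<bar>x - p j\<bar> < \<delta>}}) \<inter> topspace (Euclidean_space d)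
      = coordinate_cube d p \<delta>"
    by (auto simp: coordinate_cube_def)
  finally show ?thesis .
qed

lemma coordinate_cube_in_open:
  assumes V: "openin (Euclidean_space d) V" and p: "p \<in> V"
  obtains \<delta> where "0 < \<delta>" "coordinate_cube d p \<delta> \<subseteq> V"
proof -
  obtain T where T: "openin (powertop_real UNIV) T" "V = T \<inter> {x. \<forall>i\<ge>d. x i = 0}"
    using V unfolding Euclidean_space_def openin_subtopology by blast
  then obtain A where A: "finite {i. A i \<noteq> UNIV}" "\<And>i. open (A i)" "p \<in> Pi\<^sub>E UNIV A" "Pi\<^sub>E UNIV A \<subseteq> T"
    using p unfolding openin_product_topology_alt by auto
  have "\<exists>\<delta>>0. ball (p i) \<delta> \<subseteq> A i" for i
    using A(2,3) by (meson PiE_mem UNIV_I open_contains_ball)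
  then obtain r where r: "\<And>i. 0 < r i" "\<And>i. ball (p i) (r i) \<subseteq> A i"
    by metis
  define \<delta> where "\<delta> = Min (insert 1 (r ` {..<d}))"
  have "0 < \<delta>" and \<delta>: "\<delta> \<le> r j" if "j < d" for j
    using r(1) that by (auto simp: \<delta>_def)
  have "v \<in> V" if v: "v \<in> coordinate_cube d p \<delta>" for v
  proof -
    have "v i \<in> A i" for i
    proof (cases "i < d")
      case True
      then have "v i \<in> ball (p i) (r i)"
        using v \<delta>[OF True] by (fastforce simp: coordinate_cube_def dist_real_def)
      then show ?thesis
        using r(2) by blast
    next
      case False
      then have "v i = p i"
        using v p T(2) by (simp add: coordinate_cube_def topspace_Euclidean_space)
      then show ?thesis
        using A(3) by (simp add: PiE_iff)
    qed
    then have "v \<in> T"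
      using A(4) by (auto simp: PiE_iff)
    then show ?thesis
      using v T(2) by (simp add: coordinate_cube_def topspace_Euclidean_space)
  qed
  moreover have "0 < \<delta>"
    using r(1) by (auto simp: \<delta>_def)
  ultimately show ?thesis
    using that by blast
qed

text \<open>
  The homeomorphism \<open>x \<mapsto> \<delta> x / (1 + \<bar>x\<bar>)\<close> from the line to \<open>(-\<delta>, \<delta>)\<close>, with inverse
  \<open>x \<mapsto> x / (\<delta> - \<bar>x\<bar>)\<close>.
\<close>

lemma shrink_stretch:
  fixes x \<delta> :: real
  assumes "0 < \<delta>"
  shows "\<bar>\<delta> * x / (1 + \<bar>x\<bar>)\<bar> < \<delta>"
    and "\<delta> * x / (1 + \<bar>x\<bar>) / (\<delta> - \<bar>\<delta> * x / (1 + \<bar>x\<bar>)\<bar>) = x"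
    and "\<bar>x\<bar> < \<delta> \<Longrightarrow> \<delta> * (x / (\<delta> - \<bar>x\<bar>)) / (1 + \<bar>x / (\<delta> - \<bar>x\<bar>)\<bar>) = x"
proof -
  have pos: "0 < 1 + \<bar>x\<bar>" by linarith
  have a: "\<bar>\<delta> * x / (1 + \<bar>x\<bar>)\<bar> = \<delta> * \<bar>x\<bar> / (1 + \<bar>x\<bar>)"
    using assms pos by (simp add: abs_mult)
  show "\<bar>\<delta> * x / (1 + \<bar>x\<bar>)\<bar> < \<delta>"
    unfolding a using assms pos by (simp add: divide_less_eq algebra_simps)
  have "\<delta> - \<delta> * \<bar>x\<bar> / (1 + \<bar>x\<bar>) = \<delta> / (1 + \<bar>x\<bar>)"
    using pos by (simp add: field_simps)
  then show "\<delta> * x / (1 + \<bar>x\<bar>) / (\<delta> - \<bar>\<delta> * x / (1 + \<bar>x\<bar>)\<bar>) = x"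
    unfolding a using assms pos by simp
  assume x: "\<bar>x\<bar> < \<delta>"
  then have "1 + \<bar>x / (\<delta> - \<bar>x\<bar>)\<bar> = \<delta> / (\<delta> - \<bar>x\<bar>)"
    by (simp add: field_simps)
  then show "\<delta> * (x / (\<delta> - \<bar>x\<bar>)) / (1 + \<bar>x / (\<delta> - \<bar>x\<bar>)\<bar>) = x"
    using x assms by simp
qed

lemma coordinate_cube_homeomorphic_Euclidean_space:
  assumes p: "p \<in> topspace (Euclidean_space d)" and \<delta>: "0 < \<delta>"
  shows "subtopology (Euclidean_space d) (coordinate_cube d p \<delta>) homeomorphic_space Euclidean_space d"
proof -
  let ?B = "subtopology (Euclidean_space d) (coordinate_cube d p \<delta>)"
  let ?f = "\<lambda>v j. if j < d then (v j - p j) / (\<delta> - \<bar>v j - p j\<bar>) else 0"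
  let ?h = "\<lambda>v j. if j < d then p j + \<delta> * v j / (1 + \<bar>v j\<bar>) else 0"
  have B: "topspace ?B = coordinate_cube d p \<delta>"
    by (auto simp: coordinate_cube_def)
  have v: "continuous_map (Euclidean_space d) euclideanreal (\<lambda>v. v j)"
      "continuous_map ?B euclideanreal (\<lambda>v. v j)" for j
    using continuous_map_Euclidean_coordinate by (auto intro: continuous_map_from_subtopology)
  have "continuous_map ?B (Euclidean_space d) ?f"
    unfolding continuous_map_componentwise_Euclidean_space B
    by (intro allI impI continuous_map_real_divide continuous_map_diff continuous_map_real_abs v)
      (use \<delta> in \<open>auto simp: coordinate_cube_def\<close>)
  moreover have "continuous_map (Euclidean_space d) (Euclidean_space d) ?h"
    unfolding continuous_map_componentwise_Euclidean_space
    by (intro allI impI continuous_map_add continuous_map_real_divide continuous_map_real_mult_left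
        continuous_map_real_abs v) auto
  then have "continuous_map (Euclidean_space d) ?B ?h"
    using shrink_stretch(1)[OF \<delta>]
    by (auto simp: continuous_map_in_subtopology coordinate_cube_def topspace_Euclidean_space)
  moreover have "?h (?f v) = v" if "v \<in> topspace ?B" for v
  proof
    fix j
    have v: "v \<in> coordinate_cube d p \<delta>"
      using that B by simp
    show "?h (?f v) j = v j"
    proof (cases "j < d")
      case True
      then have "\<delta> * ((v j - p j) / (\<delta> - \<bar>v j - p j\<bar>)) / (1 + \<bar>(v j - p j) / (\<delta> - \<bar>v j - p j\<bar>)\<bar>) = v j - p j"
        using v by (intro shrink_stretch(3)[OF \<delta>]) (simp add: coordinate_cube_def)
      then show ?thesis
        using True by simp
    next
      case False
      then show ?thesis
        using v by (simp add: coordinate_cube_def topspace_Euclidean_space)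
    qed
  qed
  moreover have "?f (?h v) = v" if "v \<in> topspace (Euclidean_space d)" for v
    using that shrink_stretch(2)[OF \<delta>] by (auto simp: topspace_Euclidean_space)
  ultimately show ?thesis
    unfolding homeomorphic_space_def homeomorphic_maps_def by blast
qed

text \<open>
  The definition of a manifold only provides charts onto open subsets of Euclidean spaces.  Restricting
  to the preimage of a small cube gives a chart onto the whole Euclidean space, which is what makes
  all dilations available.
\<close>

lemma manifold_chart_inside:
  assumes M: "topological_manifold M" and W: "openin M W" and x: "x \<in> W"
  shows "\<exists>d A. openin M A \<and> x \<in> A \<and> A \<subseteq> W \<and> subtopology M A homeomorphic_space Euclidean_space d"
proof -
  have "x \<in> topspace M"
    using W x openin_subset by blast
  then obtain d A V where A: "openin M A" "x \<in> A" and V: "openin (Euclidean_space d) V"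
    and hom: "subtopology M A homeomorphic_space subtopology (Euclidean_space d) V"
    using M unfolding topological_manifold_def by blast
  then obtain f h where fh: "homeomorphic_maps (subtopology M A) (subtopology (Euclidean_space d) V) f h"
    unfolding homeomorphic_space_def by blast
  then have f: "homeomorphic_map (subtopology M A) (subtopology (Euclidean_space d) V) f"
    using homeomorphic_maps_map by blast
  have AW: "openin (subtopology M A) (A \<inter> W)"
    using A(1) W by (simp add: openin_open_subtopology openin_Int)
  have sub: "A \<inter> W \<subseteq> topspace (subtopology M A)"
    using AW by (rule openin_subset)
  have "openin (subtopology (Euclidean_space d) V) (f ` (A \<inter> W))"
    using homeomorphic_map_openness[OF f sub] AW by blast
  then have fAW: "openin (Euclidean_space d) (f ` (A \<inter> W))" "f ` (A \<inter> W) \<subseteq> V"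
    by (simp_all add: openin_open_subtopology[OF V])
  moreover have "f x \<in> f ` (A \<inter> W)"
    using A x by blast
  ultimately obtain \<delta> where \<delta>: "0 < \<delta>" "coordinate_cube d (f x) \<delta> \<subseteq> f ` (A \<inter> W)"
    using coordinate_cube_in_open by metis
  have fx: "f x \<in> topspace (Euclidean_space d)"
    using fAW(1) \<open>f x \<in> f ` (A \<inter> W)\<close> openin_subset by blast
  let ?D = "{y \<in> A \<inter> W. f y \<in> coordinate_cube d (f x) \<delta>}"
  \<comment> \<open>Injectivity of the chart shows that the preimage of the cube lies in \<open>W\<close>.\<close>
  have D: "?D = {y \<in> topspace (subtopology M A). f y \<in> coordinate_cube d (f x) \<delta>}"
  proof -
    have "y \<in> W" if y: "y \<in> topspace (subtopology M A)" "f y \<in> coordinate_cube d (f x) \<delta>" for y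
    proof -
      obtain z where "z \<in> A \<inter> W" "f y = f z"
        using y(2) \<delta>(2) by blast
      then show ?thesis
        using y(1) sub f by (metis Int_iff homeomorphic_imp_injective_map inj_onD subsetD)
    qed
    then show ?thesis
      using sub by auto
  qed
  have cubeV: "openin (subtopology (Euclidean_space d) V) (coordinate_cube d (f x) \<delta>)"
    using \<delta>(2) fAW(2) openin_coordinate_cube by (simp add: openin_open_subtopology[OF V])
  have Dopen: "openin (subtopology M A) ?D"
    unfolding D using homeomorphic_imp_continuous_map[OF f] cubeV by (rule openin_continuous_map_preimage)
  have "f ` ?D = coordinate_cube d (f x) \<delta>"
    using \<delta>(2) by auto
  then have hm: "homeomorphic_map (subtopology (subtopology M A) ?D)
      (subtopology (subtopology (Euclidean_space d) V) (coordinate_cube d (f x) \<delta>)) f"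
    using homeomorphic_map_subtopologies[OF f, of ?D "coordinate_cube d (f x) \<delta>"] openin_subset[OF Dopen] openin_subset[OF cubeV]
    by (simp add: Int_absorb1)
  have eqM: "subtopology (subtopology M A) ?D = subtopology M ?D"
    unfolding subtopology_subtopology by (rule arg_cong[of _ _ "subtopology _"]) auto
  have eqE: "subtopology (subtopology (Euclidean_space d) V) (coordinate_cube d (f x) \<delta>)
      = subtopology (Euclidean_space d) (coordinate_cube d (f x) \<delta>)"
    unfolding subtopology_subtopology using \<delta>(2) fAW(2)
    by (intro arg_cong[of _ _ "subtopology _"]) auto
  have "subtopology M ?D homeomorphic_space subtopology (Euclidean_space d) (coordinate_cube d (f x) \<delta>)"
    using hm unfolding eqM eqE by (rule homeomorphic_map_imp_homeomorphic_space)
  then have "subtopology M ?D homeomorphic_space Euclidean_space d"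
    using coordinate_cube_homeomorphic_Euclidean_space[OF fx \<delta>(1)] homeomorphic_space_trans by blast
  moreover have "openin M ?D"
    using Dopen A(1) openin_open_subtopology by blast
  moreover have "x \<in> ?D"
    using A x fx \<delta>(1) by (simp add: coordinate_cube_def)
  moreover have "?D \<subseteq> W"
    by blast
  ultimately show ?thesis
    by blast
qed

lemma Hausdorff_separate_finite:
  assumes M: "Hausdorff_space M" and X: "finite X" "X \<subseteq> topspace M"
  obtains O' where "\<And>x. x \<in> X \<Longrightarrow> openin M (O' x) \<and> x \<in> O' x"
    "\<And>x y. x \<in> X \<Longrightarrow> y \<in> X \<Longrightarrow> x \<noteq> y \<Longrightarrow> O' x \<inter> O' y = {}"
proof -
  have "\<exists>A B. openin M A \<and> openin M B \<and> x \<in> A \<and> y \<in> B \<and> A \<inter> B = {}" if "x \<in> X" "y \<in> X" "x \<noteq> y" for x y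
    using M X(2) that unfolding Hausdorff_space_def disjnt_def by blast
  then obtain A B where AB: "\<And>x y. x \<in> X \<Longrightarrow> y \<in> X \<Longrightarrow> x \<noteq> y \<Longrightarrow>
      openin M (A x y) \<and> openin M (B x y) \<and> x \<in> A x y \<and> y \<in> B x y \<and> A x y \<inter> B x y = {}"
    by metis
  let ?O = "\<lambda>x. (\<Inter>y\<in>X - {x}. A x y \<inter> B y x) \<inter> topspace M"
  show ?thesis
  proof (rule that[of ?O])
    fix x assume x: "x \<in> X"
    have "openin M (?O x)"
      using X(1) AB x by (intro openin_INT) (auto intro!: openin_Int)
    then show "openin M (?O x) \<and> x \<in> ?O x"
      using AB x X(2) by auto
  next
    fix x y assume xy: "x \<in> X" "y \<in> X" "x \<noteq> y"
    have "?O x \<subseteq> A x y" "?O y \<subseteq> B x y"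
      using xy by auto
    then show "?O x \<inter> ?O y = {}"
      using AB[OF xy] by blast
  qed
qed

text \<open>
  A bijection \<open>\<beta>\<close> of \<open>{..<k}\<close> with the pairs of a chart and one of its coordinates carries out the
  concatenation of the coordinates.
\<close>

lemma chart_family_of_charts:
  assumes n: "1 \<le> n"
    and A: "\<And>i. i < n \<Longrightarrow> openin M (A i)"
    and disj: "\<And>i j. i < n \<Longrightarrow> j < n \<Longrightarrow> i \<noteq> j \<Longrightarrow> A i \<inter> A j = {}"
    and hom: "\<And>i. i < n \<Longrightarrow> homeomorphic_maps (subtopology M (A i)) (Euclidean_space (d i)) (f i) (h i)"
  shows "\<exists>k block idx \<psi> g. chart_family (subtopology M (\<Union>i<n. A i)) n k block idx \<psi> g \<and>
    (\<forall>i<n. \<forall>x\<in>A i. idx x = i)"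
proof -
  let ?W = "\<Union>i<n. A i" let ?M = "subtopology M ?W"
  let ?J = "SIGMA i:{..<n}. {..<d i}"
  define k where "k = card ?J"
  obtain \<beta> where \<beta>: "bij_betw \<beta> {..<k} ?J"
    using ex_bij_betw_nat_finite[of ?J] by (auto simp: k_def atLeast0LessThan)
  define block where "block j = fst (\<beta> j)" for j
  define \<iota> where "\<iota> = inv_into {..<k} \<beta>"
  define idx where "idx x = (THE i. i < n \<and> x \<in> A i)" for x
  define \<psi> where "\<psi> x j = (if j < k \<and> block j = idx x then f (idx x) x (snd (\<beta> j)) else 0)" for x j
  define cut where "cut i v = (\<lambda>l. if l < d i then v (\<iota> (i, l)) else 0)" for i and v :: "nat \<Rightarrow> real"
  define g where "g i v = h i (cut i v)" for i v
  have AM: "A i \<subseteq> topspace M" if "i < n" for i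
    using A[OF that] by (rule openin_subset)
  have idx: "idx x = i" if "i < n" "x \<in> A i" for x i
    unfolding idx_def
  proof (rule the_equality)
    fix l assume "l < n \<and> x \<in> A l"
    then show "l = i"
      using disj[of l i] that by blast
  qed (use that in blast)
  have \<beta>_in: "block j < n" "snd (\<beta> j) < d (block j)" if "j < k" for j
  proof -
    have "\<beta> j \<in> ?J"
      using bij_betwE[OF \<beta>] that by simp
    then show "block j < n" "snd (\<beta> j) < d (block j)"
      by (auto simp: block_def)
  qed
  have \<iota>: "\<iota> (i, l) < k" "\<beta> (\<iota> (i, l)) = (i, l)" if "i < n" "l < d i" for i l
  proof -
    have "(i, l) \<in> \<beta> ` {..<k}"
      using \<beta> that by (simp add: bij_betw_def)
    then show "\<iota> (i, l) < k" "\<beta> (\<iota> (i, l)) = (i, l)"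
      using inv_into_into[of "(i, l)" \<beta> "{..<k}"] by (simp_all add: \<iota>_def f_inv_into_f)
  qed
  have \<iota>_\<beta>: "\<iota> (\<beta> j) = j" if "j < k" for j
    using \<beta> that unfolding \<iota>_def bij_betw_def by (simp add: inv_into_f_f)
  have topA: "topspace (subtopology M (A i)) = A i" if "i < n" for i
    using AM[OF that] by auto
  have f_in: "f i x \<in> topspace (Euclidean_space (d i))" and h_f: "h i (f i x) = x" if "i < n" "x \<in> A i" for i x
    using hom[OF that(1)] that topA[OF that(1)] by (auto simp: homeomorphic_maps_def continuous_map_def Pi_iff)
  have h_in: "h i v \<in> A i" and f_h: "f i (h i v) = v" if "i < n" "v \<in> topspace (Euclidean_space (d i))" for i v
    using hom[OF that(1)] that topA[OF that(1)] by (auto simp: homeomorphic_maps_def continuous_map_def Pi_iff)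
  have cut_in: "cut i v \<in> topspace (Euclidean_space (d i))" for i v
    by (simp add: cut_def topspace_Euclidean_space)
  have cut_\<psi>: "cut i (\<psi> x) = f i x" if i: "i < n" and x: "x \<in> A i" for i x
  proof
    fix l show "cut i (\<psi> x) l = f i x l"
    proof (cases "l < d i")
      case True
      then show ?thesis
        using \<iota>[OF i True] by (simp add: cut_def \<psi>_def block_def idx[OF i x])
    next
      case False
      then show ?thesis
        using f_in[OF i x] by (simp add: cut_def topspace_Euclidean_space)
    qed
  qed
  have topM: "topspace ?M = ?W"
    using AM by auto
  have openA: "openin ?M (A i)" if "i < n" for i
    using A[OF that] that by (auto simp: openin_subtopology_alt intro!: image_eqI[of _ _ "A i"])
  have subA: "subtopology ?M (A i) = subtopology M (A i)" if "i < n" for i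
    unfolding subtopology_subtopology using that by (intro arg_cong[of _ _ "subtopology _"]) auto
  have fib: "{x \<in> topspace ?M. idx x = i} = (if i < n then A i else {})" for i
    unfolding topM using idx by auto
  have "chart_family ?M n k block idx \<psi> g"
  proof
    show "idx x < n" if "x \<in> topspace ?M" for x
      using that idx unfolding topM by auto
    show "openin ?M {x \<in> topspace ?M. idx x = i}" for i
      unfolding fib using openA by simp
    show "continuous_map ?M (Euclidean_space k) \<psi>"
    proof (rule continuous_map_locally)
      fix x assume "x \<in> topspace ?M"
      then obtain i where i: "i < n" "x \<in> A i"
        unfolding topM by auto
      let ?h = "\<lambda>x j. if j < k then (if block j = i then f i x (snd (\<beta> j)) else 0) else 0"
      have "continuous_map (subtopology M (A i)) (Euclidean_space (d i)) (f i)"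
        using hom[OF i(1)] by (simp add: homeomorphic_maps_def)
      from continuous_map_compose[OF this continuous_map_Euclidean_coordinate]
      have "continuous_map (subtopology M (A i)) euclideanreal (\<lambda>x. f i x l)" for l
        by (simp add: o_def)
      then have "continuous_map (subtopology M (A i)) (Euclidean_space k) ?h"
        unfolding continuous_map_componentwise_Euclidean_space by auto
      moreover have "\<forall>a\<in>A i. \<psi> a = ?h a"
        using idx[OF i(1)] by (auto simp: \<psi>_def)
      ultimately show "\<exists>T q. openin ?M T \<and> x \<in> T \<and> continuous_map (subtopology ?M T) (Euclidean_space k) q \<and>
          (\<forall>a\<in>T. \<psi> a = q a)"
        using openA[OF i(1)] i subA[OF i(1)] by (intro exI[of _ "A i"] exI[of _ ?h]) simp
    qed
    show "continuous_map (Euclidean_space k) ?M (g i)" if i: "i < n" for i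
    proof -
      have "continuous_map (Euclidean_space k) (Euclidean_space (d i)) (cut i)"
        unfolding cut_def continuous_map_componentwise_Euclidean_space
        by (simp add: continuous_map_Euclidean_coordinate)
      moreover have "continuous_map (Euclidean_space (d i)) (subtopology ?M (A i)) (h i)"
        using hom[OF i] by (simp add: subA[OF i] homeomorphic_maps_def)
      then have "continuous_map (Euclidean_space (d i)) ?M (h i)"
        by (simp only: continuous_map_in_subtopology)
      ultimately have "continuous_map (Euclidean_space k) ?M (h i \<circ> cut i)"
        by (rule continuous_map_compose)
      moreover have "h i \<circ> cut i = g i"
        by (auto simp: g_def)
      ultimately show ?thesis
        by simp
    qed
    show "idx (g i v) = i" if "i < n" for i v
      using idx[OF that h_in[OF that cut_in]] by (simp add: g_def)
    show "\<psi> (g i v) j = (if block j = i then v j else 0)"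
      if i: "i < n" and v: "v \<in> topspace (Euclidean_space k)" for i v j
    proof -
      have "idx (g i v) = i" "f i (g i v) = cut i v"
        using idx[OF i h_in[OF i cut_in]] f_h[OF i cut_in] by (simp_all add: g_def)
      moreover have "cut i v (snd (\<beta> j)) = v j" if "j < k" "block j = i"
        using \<beta>_in[OF that(1)] \<iota>_\<beta>[OF that(1)] that(2) by (metis block_def cut_def prod.collapse)
      moreover have "v j = 0" if "\<not> j < k"
        using v that by (simp add: topspace_Euclidean_space)
      ultimately show ?thesis
        by (auto simp: \<psi>_def)
    qed
    show "g (idx x) (\<psi> x) = x" if "x \<in> topspace ?M" for x
    proof -
      obtain i where i: "i < n" "x \<in> A i"
        using \<open>x \<in> topspace ?M\<close> unfolding topM by auto
      then show ?thesis
        by (simp add: g_def idx cut_\<psi> h_f)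
    qed
  qed (use n \<beta>_in in auto)
  then show ?thesis
    using idx by blast
qed

lemma chart_family_around:
  assumes M: "topological_manifold M" and X: "X \<in> Ran M"
  shows "\<exists>W k block idx \<psi> g. openin M W \<and> X \<subseteq> W \<and> idx ` X = {..<card X} \<and>
    chart_family (subtopology M W) (card X) k block idx \<psi> g"
proof -
  let ?n = "card X"
  have X': "finite X" "X \<noteq> {}" "X \<subseteq> topspace M"
    using X by (auto simp: Ran_def)
  then obtain O' where O': "\<And>x. x \<in> X \<Longrightarrow> openin M (O' x) \<and> x \<in> O' x"
    "\<And>x y. x \<in> X \<Longrightarrow> y \<in> X \<Longrightarrow> x \<noteq> y \<Longrightarrow> O' x \<inter> O' y = {}"
    using Hausdorff_separate_finite[of M X] M unfolding topological_manifold_def by metis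
  have "\<exists>d A. openin M A \<and> x \<in> A \<and> A \<subseteq> O' x \<and> subtopology M A homeomorphic_space Euclidean_space d"
    if "x \<in> X" for x
    using manifold_chart_inside[OF M] O'(1)[OF that] by blast
  then obtain d A where A: "\<And>x. x \<in> X \<Longrightarrow> openin M (A x) \<and> x \<in> A x \<and> A x \<subseteq> O' x \<and>
      subtopology M (A x) homeomorphic_space Euclidean_space (d x)"
    by metis
  then have "\<exists>f h. homeomorphic_maps (subtopology M (A x)) (Euclidean_space (d x)) f h" if "x \<in> X" for x
    using that unfolding homeomorphic_space_def by blast
  then obtain f h where fh: "\<And>x. x \<in> X \<Longrightarrow> homeomorphic_maps (subtopology M (A x)) (Euclidean_space (d x)) (f x) (h x)"
    by metis
  obtain \<xi> where \<xi>: "bij_betw \<xi> {..<?n} X"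
    using ex_bij_betw_nat_finite[OF X'(1)] by (auto simp: atLeast0LessThan)
  have \<xi>X: "\<xi> i \<in> X" if "i < ?n" for i
    using \<xi> that by (auto simp: bij_betw_def)
  have "A (\<xi> i) \<inter> A (\<xi> j) = {}" if ij: "i < ?n" "j < ?n" "i \<noteq> j" for i j
  proof -
    have "\<xi> i \<noteq> \<xi> j"
      using \<xi> ij by (auto simp: bij_betw_def inj_on_def)
    then show ?thesis
      using O'(2)[OF \<xi>X \<xi>X] A[OF \<xi>X] ij by blast
  qed
  moreover have "1 \<le> ?n"
    using X' by (simp add: Suc_leI card_gt_0_iff)
  ultimately obtain k block idx \<psi> g
    where cf: "chart_family (subtopology M (\<Union>i<?n. A (\<xi> i))) ?n k block idx \<psi> g"
      and idx: "\<forall>i<?n. \<forall>x\<in>A (\<xi> i). idx x = i"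
    using chart_family_of_charts[of ?n M "\<lambda>i. A (\<xi> i)" "\<lambda>i. d (\<xi> i)" "\<lambda>i. f (\<xi> i)" "\<lambda>i. h (\<xi> i)"]
      A fh \<xi>X by blast
  have im: "X = \<xi> ` {..<?n}"
    using \<xi> by (simp add: bij_betw_def)
  have "idx (\<xi> i) = i" if "i < ?n" for i
    using idx A[OF \<xi>X[OF that]] that by blast
  then have "idx ` \<xi> ` {..<?n} = {..<?n}"
    by (simp add: image_image)
  then have "idx ` X = {..<?n}"
    using im by simp
  moreover have "X \<subseteq> (\<Union>i<?n. A (\<xi> i))"
  proof
    fix x assume "x \<in> X"
    then obtain i where "i < ?n" "x = \<xi> i"
      using \<xi> by (auto simp: bij_betw_def)
    then show "x \<in> (\<Union>i<?n. A (\<xi> i))"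
      using A[OF \<xi>X] by blast
  qed
  moreover have "openin M (\<Union>i<?n. A (\<xi> i))"
    using A \<xi>X by (intro openin_Union) auto
  ultimately show ?thesis
    using cf by blast
qed

section \<open>The conical structure\<close>

lemma Ran_fin_locally_conical:
  fixes M :: "'a topology"
  assumes M: "topological_manifold M" and X: "X \<in> Ran M"
  shows "\<exists>U k (L :: 'a set topology) (sL :: 'a set \<Rightarrow> nat) h.
        neighbourhood_of (Ran_fin M) X U \<and>
        stratified_space {card X + 1..} L sL \<and>
        stratified_homeomorphism (subtopology (Ran_fin M) U) card
          (prod_topology (Euclidean_space k) (open_cone L)) (\<lambda>(e, z). cone_strat (card X) sL z) h"
proof -
  obtain W k block idx \<psi> g where W: "openin M W" "X \<subseteq> W" and idx_X: "idx ` X = {..<card X}"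
    and cf: "chart_family (subtopology M W) (card X) k block idx \<psi> g"
    using chart_family_around[OF M X] by blast
  interpret chart_family "subtopology M W" "card X" k block idx \<psi> g
    by (rule cf)
  have sub: "U \<subseteq> Ran (subtopology M W)"
    using U_Ran by blast
  have restrict: "subtopology (Ran_fin (subtopology M W)) U = subtopology (Ran_fin M) U"
    unfolding Ran_fin_open_subspace(2)[OF W(1), symmetric] subtopology_subtopology
    using sub by (simp add: Int_absorb1)
  have nbh: "neighbourhood_of (Ran_fin M) X U"
  proof -
    have "openin (Ran_fin M) U"
      using clopen_U(1) Ran_fin_open_subspace[OF W(1)] openin_open_subtopology by metis
    moreover have "X \<in> U"
      using X W idx_X by (simp add: U_def Ran_subtopology)
    ultimately show ?thesis
      unfolding neighbourhood_of_def using openin_subset by blast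
  qed
  have "Hausdorff_space (subtopology M W)"
    using M by (simp add: topological_manifold_def Hausdorff_space_subtopology)
  then have strat: "stratified_space {card X + 1..} L card"
    by (rule stratified_space_link)
  show ?thesis
    using nbh strat stratified_homeomorphism_cone unfolding restrict by blast
qed

theorem corollary7p44:
  fixes M :: "'a topology"
  assumes "topological_manifold M"
  shows "naively_conical {1..} (Ran_fin M) card \<and>
    (\<forall>X \<in> Ran M. \<forall>n. card X = n \<longrightarrow>
      (\<exists>U k (L :: 'a set topology) (sL :: 'a set \<Rightarrow> nat) h.
        neighbourhood_of (Ran_fin M) X U \<and>
        stratified_space {n + 1..} L sL \<and>
        stratified_homeomorphism (subtopology (Ran_fin M) U) card
          (prod_topology (Euclidean_space k) (open_cone L)) (\<lambda>(e, z). cone_strat n sL z) h))"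
proof (intro conjI ballI allI impI)
  have strata: "{p \<in> {1..}. card X < p} = {card X + 1..}" for X :: "'a set"
    by auto
  have "stratified_space {1..} (Ran_fin M) card"
    using assms by (intro stratified_space_card_Ran_fin) (simp add: topological_manifold_def)
  then show "naively_conical {1..} (Ran_fin M) card"
    using Ran_fin_locally_conical[OF assms]
    unfolding naively_conical_def topspace_Ran_fin strata case_prod_unfold
    by blast
qed (use Ran_fin_locally_conical[OF assms] in blast)

end
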